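(* Let $\alpha\vDash n$ and let $0\le m\le n$. The restriction of the $H_n(0)$-module $\mathcal{V}_\alpha$ to the subalgebra $H_m(0)\otimes H_{n-m}(0)$ decomposes (as an $H_m(0)\otimes H_{n-m}(0)$-module) as $$\mathcal{V}_\alpha\big\downarrow^{H_n(0)}_{H_m(0)\otimes H_{n-m}(0)}\cong\bigoplus_{\substack{\beta\vDash m\\ \beta\subseteq\alpha}}\mathcal{V}_\beta\otimes\mathcal{V}_{\alpha/\beta}.$$ In particular, $$\mathcal{V}_\alpha\big\downarrow^{H_n(0)}_{H_{n-1}(0)}\cong\bigoplus_{\substack{\beta\vDash n-1\\ \beta\subset\alpha}}\mathcal{V}_\beta,$$ that is, the sum on the right runs over all compositions $\beta$ such that $\alpha/\beta$ consists of a single cell.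
   Context: Compositions and tableaux. A composition $\alpha=(\alpha_1,\dots,\alpha_k)\vDash n$ is a finite sequence of positive integers with sum $n=|\alpha|$; $\ell(\alpha)=k$; $\emptyset$ is the empty composition of $0$. The diagram of $\alpha$ is the left-justified array of cells with $\alpha_i$ cells in row $i$, rows numbered from bottom to top. $\beta\subseteq\alpha$ means $\ell(\beta)\le\ell(\alpha)$ and $\beta_j\le\alpha_j$ for all $1\le j\le \ell(\beta)$; the skew diagram $\alpha/\beta$ is the set of cells of the diagram of $\alpha$ not in that of $\beta$, where $\beta$ is placed in the bottom-left corner of $\alpha$. $\mathrm{SIT}(\alpha/\beta)$ is the set of bijective fillings of the cells of $\alpha/\beta$ with $1,\dots,|\alpha|-|\beta|$ such that the entries in the cells of the leftmost column of $\alpha$ that are not in $\beta$ increase from bottom to top, and all rows increase from left to right; $\mathrm{SIT}(\alpha)=\mathrm{SIT}(\alpha/\emptyset)$. 0-Hecke algebra. $H_N(0)$ is the $\mathbb{C}$-algebra with generators $\pi_1,\dots,\pi_{N-1}$ and relations $\pi_i^2=\pi_i$, $\pi_i\pi_{i+1}\pi_i=\pi_{i+1}\pi_i\pi_{i+1}$, $\pi_i\pi_j=\pi_j\pi_i$ for $|i-j|\ge2$; $H_0(0)=H_1(0)=\mathbb{C}$. $H_m(0)\otimes H_{n-m}(0)$ is identified with the subalgebra of $H_n(0)$ generated by $\{\pi_1,\dots,\pi_{m-1},\pi_{m+1},\dots,\pi_{n-1}\}$ via $\pi_i\mapsto\pi_i\otimes1$ for $1\le i\le m-1$ and $\pi_i\mapsto1\otimes\pi_{i-m}$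 for $m+1\le i\le n-1$. In particular $H_{n-1}(0)$ is the subalgebra generated by $\pi_1,\dots,\pi_{n-2}$. Modules. $\mathcal{V}_{\alpha/\beta}$ is the $H_{|\alpha|-|\beta|}(0)$-module with $\mathbb{C}$-basis $\mathrm{SIT}(\alpha/\beta)$ and the following ($\mathcal{R}\mathfrak{S}^*$-)action: $\pi_i(T)=T$ if $i+1$ is in a row strictly above $i$ in $T$; $\pi_i(T)=s_i(T)$ (the tableau with $i$ and $i+1$ switched) if $i+1$ is in a row strictly below $i$; $\pi_i(T)=0$ if $i,i+1$ are in the same row. $\mathcal{V}_\alpha=\mathcal{V}_{\alpha/\emptyset}$. *)

theory Defs
  imports "HOL-Algebra.Algebra" "HOL-Library.Poly_Mapping" "HOL-Combinatorics.Transposition"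
begin

section \<open>Modules over noncommutative rings\<close>

text \<open>The axioms are those of \<^locale>\<open>module\<close>, which however insists on a commutative ring of
  scalars. The record fields \<open>mult\<close> and \<open>one\<close> of a module are irrelevant.\<close>

locale left_module = R?: ring R + M?: abelian_group M
  for R :: "('a, 'd) ring_scheme" (structure) and M :: "('a, 'b, 'c) module_scheme" (structure) +
  assumes smult_closed:
      "a \<in> carrier R \<Longrightarrow> x \<in> carrier M \<Longrightarrow> a \<odot>\<^bsub>M\<^esub> x \<in> carrier M"
    and smult_l_distr:
      "a \<in> carrier R \<Longrightarrow> b \<in> carrier R \<Longrightarrow> x \<in> carrier M \<Longrightarrow>
        (a \<oplus>\<^bsub>R\<^esub> b) \<odot>\<^bsub>M\<^esub> x = a \<odot>\<^bsub>M\<^esub> x \<oplus>\<^bsub>M\<^esub> b \<odot>\<^bsub>M\<^esub> x"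
    and smult_r_distr:
      "a \<in> carrier R \<Longrightarrow> x \<in> carrier M \<Longrightarrow> y \<in> carrier M \<Longrightarrow>
        a \<odot>\<^bsub>M\<^esub> (x \<oplus>\<^bsub>M\<^esub> y) = a \<odot>\<^bsub>M\<^esub> x \<oplus>\<^bsub>M\<^esub> a \<odot>\<^bsub>M\<^esub> y"
    and smult_assoc:
      "a \<in> carrier R \<Longrightarrow> b \<in> carrier R \<Longrightarrow> x \<in> carrier M \<Longrightarrow>
        (a \<otimes>\<^bsub>R\<^esub> b) \<odot>\<^bsub>M\<^esub> x = a \<odot>\<^bsub>M\<^esub> (b \<odot>\<^bsub>M\<^esub> x)"
    and smult_one:
      "x \<in> carrier M \<Longrightarrow> \<one>\<^bsub>R\<^esub> \<odot>\<^bsub>M\<^esub> x = x"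

definition module_isomorphic ::
    "('a, 'd) ring_scheme \<Rightarrow> ('a, 'b, 'e) module_scheme \<Rightarrow> ('a, 'c, 'f) module_scheme \<Rightarrow> bool" where
  "module_isomorphic R M N \<longleftrightarrow> left_module R M \<and> left_module R N \<and>
     (\<exists>\<phi> \<in> iso (add_monoid M) (add_monoid N).
        \<forall>a \<in> carrier R. \<forall>x \<in> carrier M. \<phi> (a \<odot>\<^bsub>M\<^esub> x) = a \<odot>\<^bsub>N\<^esub> \<phi> x)"

definition direct_sum :: "'i set \<Rightarrow> ('i \<Rightarrow> ('a, 'b) module) \<Rightarrow> ('a, 'i \<Rightarrow> 'b) module" where
  "direct_sum I M =
     \<lparr>carrier = {f \<in> \<Pi>\<^sub>E i\<in>I. carrier (M i). finite {i \<in> I. f i \<noteq> \<zero>\<^bsub>M i\<^esub>}},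
      monoid.mult = undefined, one = undefined,
      ring.zero = (\<lambda>i\<in>I. \<zero>\<^bsub>M i\<^esub>),
      ring.add = (\<lambda>f g. \<lambda>i\<in>I. f i \<oplus>\<^bsub>M i\<^esub> g i),
      module.smult = (\<lambda>a f. \<lambda>i\<in>I. a \<odot>\<^bsub>M i\<^esub> f i)\<rparr>"


section \<open>The 0-Hecke algebra\<close>

type_synonym free_elem = "nat list \<Rightarrow>\<^sub>0 complex"
type_synonym hecke_elem = "free_elem set"

instantiation list :: (type) monoid_add
begin
definition "0 = ([] :: 'a list)"
definition "xs + ys = (xs @ ys :: 'a list)"
instance by standard (simp_all add: zero_list_def plus_list_def)
end

text \<open>With concatenation as monoid operation on words, \<^typ>\<open>nat list \<Rightarrow>\<^sub>0 complex\<close> with its library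
  multiplication is the free algebra on generators indexed by \<^typ>\<open>nat\<close>; the free algebra on
  the letters $1, \dots, N-1$ is cut out by a condition on the words that occur.\<close>

definition free_alg :: "nat \<Rightarrow> free_elem ring" where
  "free_alg N =
     \<lparr>carrier = {f. \<forall>w \<in> Poly_Mapping.keys f. set w \<subseteq> {1..<N}},
      monoid.mult = (*), one = 1, ring.zero = 0, ring.add = (+)\<rparr>"

definition letter :: "nat \<Rightarrow> free_elem" where
  "letter i = Poly_Mapping.single [i] 1"

definition hecke_relations :: "nat \<Rightarrow> free_elem set" where
  "hecke_relations N =
     {letter i * letter i - letter i | i. i \<in> {1..<N}} \<union>
     {letter i * letter (i + 1) * letter i - letter (i + 1) * letter i * letter (i + 1)
        | i. i \<in> {1..<N} \<and> i + 1 \<in> {1..<N}} \<union>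
     {letter i * letter j - letter j * letter i
        | i j. i \<in> {1..<N} \<and> j \<in> {1..<N} \<and> \<bar>int i - int j\<bar> \<ge> 2}"

definition hecke_ideal :: "nat \<Rightarrow> free_elem set" where
  "hecke_ideal N = Idl\<^bsub>free_alg N\<^esub> (hecke_relations N)"

definition hecke :: "nat \<Rightarrow> hecke_elem ring" where
  "hecke N = free_alg N Quot hecke_ideal N"

definition hecke_class :: "nat \<Rightarrow> free_elem \<Rightarrow> hecke_elem" where
  "hecke_class N f = hecke_ideal N +>\<^bsub>free_alg N\<^esub> f"

definition hecke_gen :: "nat \<Rightarrow> nat \<Rightarrow> hecke_elem" where
  "hecke_gen N i = hecke_class N (letter i)"

text \<open>The copy of the complex numbers in the algebra. A module over the ring \<^term>\<open>hecke N\<close> (or over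
  one of the subalgebras below) is a complex vector space through these elements, and
  isomorphisms of modules are therefore complex linear.\<close>

definition hecke_scalar :: "nat \<Rightarrow> complex \<Rightarrow> hecke_elem" where
  "hecke_scalar N c = hecke_class N (Poly_Mapping.single [] c)"

definition hecke_subalgebra :: "nat \<Rightarrow> nat set \<Rightarrow> hecke_elem ring" where
  "hecke_subalgebra N J =
     (hecke N)\<lparr>carrier := generate_ring (hecke N) (range (hecke_scalar N) \<union> hecke_gen N ` J)\<rparr>"

text \<open>The algebra map from \<^term>\<open>hecke N\<close> to \<^term>\<open>hecke N'\<close> (where \<open>N + k \<le> N'\<close>) that sends the
  generator with index \<open>i\<close> to the one with index \<open>i + k\<close>; it is injective.\<close>

definition shift_letters :: "nat \<Rightarrow> free_elem \<Rightarrow> free_elem" where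
  "shift_letters k f =
     (\<Sum>w \<in> Poly_Mapping.keys f.
        Poly_Mapping.single (map (\<lambda>i. i + k) w) (Poly_Mapping.lookup f w))"

definition hecke_embed ::
    "nat \<Rightarrow> nat \<Rightarrow> nat \<Rightarrow> hecke_elem \<Rightarrow> hecke_elem" where
  "hecke_embed k N N' x = the_elem ((\<lambda>f. hecke_class N' (shift_letters k f)) ` x)"

text \<open>The subalgebra of \<^term>\<open>hecke n\<close> with which the tensor product of \<^term>\<open>hecke m\<close> and
  \<^term>\<open>hecke (n - m)\<close> is identified. Under the identification, $a \otimes b$ is the product of
  \<^term>\<open>hecke_embed 0 m n a\<close> and \<^term>\<open>hecke_embed m (n - m) n b\<close>.\<close>

definition hecke_tensor :: "nat \<Rightarrow> nat \<Rightarrow> hecke_elem ring" where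
  "hecke_tensor m n = hecke_subalgebra n ({1..<n} - {m})"

text \<open>A module over \<^term>\<open>hecke N\<close>, viewed as a module over the image of \<^term>\<open>hecke N\<close> in
  \<^term>\<open>hecke N'\<close>.\<close>

definition transport_embed :: "nat \<Rightarrow> nat \<Rightarrow> (hecke_elem, 'b) module \<Rightarrow>
    (hecke_elem, 'b) module" where
  "transport_embed N N' M = M\<lparr>module.smult := (\<lambda>x v.
     the_elem {a \<odot>\<^bsub>M\<^esub> v | a. a \<in> carrier (hecke N) \<and> hecke_embed 0 N N' a = x})\<rparr>"


section \<open>Tensor products of modules\<close>

text \<open>If \<open>V\<close> and \<open>W\<close> are complex subspaces of \<open>X \<Rightarrow>\<^sub>0 complex\<close> and \<open>Y \<Rightarrow>\<^sub>0 complex\<close>, then their tensor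
  product is the span of the pure tensors in \<open>X \<times> Y \<Rightarrow>\<^sub>0 complex\<close>. Scalars can be absorbed in one
  factor, so sums of pure tensors suffice.\<close>

definition pure_tensor :: "('x \<Rightarrow>\<^sub>0 complex) \<Rightarrow> ('y \<Rightarrow>\<^sub>0 complex) \<Rightarrow> ('x \<times> 'y \<Rightarrow>\<^sub>0 complex)" where
  "pure_tensor v w =
     (\<Sum>x \<in> Poly_Mapping.keys v. \<Sum>y \<in> Poly_Mapping.keys w.
        Poly_Mapping.single (x, y) (Poly_Mapping.lookup v x * Poly_Mapping.lookup w y))"

text \<open>The tensor product of a module \<open>V\<close> over \<^term>\<open>hecke m\<close> and a module \<open>W\<close> over
  \<^term>\<open>hecke (n - m)\<close>, as a module over \<^term>\<open>hecke_tensor m n\<close>: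
  $(\sum_k a_k \otimes b_k) (\sum_l v_l \otimes w_l) = \sum_k \sum_l a_k v_l \otimes b_k w_l$.\<close>

definition tensor_module :: "nat \<Rightarrow> nat \<Rightarrow>
    (hecke_elem, 'x \<Rightarrow>\<^sub>0 complex) module \<Rightarrow>
    (hecke_elem, 'y \<Rightarrow>\<^sub>0 complex) module \<Rightarrow>
    (hecke_elem, 'x \<times> 'y \<Rightarrow>\<^sub>0 complex) module" where
  "tensor_module m n V W =
     \<lparr>carrier = {\<Sum>l<s. pure_tensor (v l) (w l) | (s :: nat) v w.
                   \<forall>l<s. v l \<in> carrier V \<and> w l \<in> carrier W},
      monoid.mult = undefined, one = undefined, ring.zero = 0, ring.add = (+),
      module.smult = (\<lambda>x t. the_elem
        {\<Sum>k<r. \<Sum>l<s. pure_tensor (a k \<odot>\<^bsub>V\<^esub> v l) (b k \<odot>\<^bsub>W\<^esub> w l) | (r :: nat) a b (s :: nat) v w.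
           (\<forall>k<r. a k \<in> carrier (hecke m) \<and> b k \<in> carrier (hecke (n - m))) \<and>
           x = (\<Oplus>\<^bsub>hecke n\<^esub>k\<in>{..<r}.
                  hecke_embed 0 m n (a k) \<otimes>\<^bsub>hecke n\<^esub> hecke_embed m (n - m) n (b k)) \<and>
           (\<forall>l<s. v l \<in> carrier V \<and> w l \<in> carrier W) \<and>
           t = (\<Sum>l<s. pure_tensor (v l) (w l))})\<rparr>"


section \<open>Compositions and standard immaculate tableaux\<close>

definition is_composition :: "nat list \<Rightarrow> nat \<Rightarrow> bool" where
  "is_composition \<alpha> n \<longleftrightarrow> (\<forall>a \<in> set \<alpha>. 0 < a) \<and> sum_list \<alpha> = n"

definition comp_contained :: "nat list \<Rightarrow> nat list \<Rightarrow> bool" where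
  "comp_contained \<beta> \<alpha> \<longleftrightarrow> length \<beta> \<le> length \<alpha> \<and> (\<forall>j < length \<beta>. \<beta> ! j \<le> \<alpha> ! j)"

text \<open>Cells are pairs (row, column), both counted from 0; row 0 is the bottom row and column 0
  the leftmost one.\<close>

definition diagram :: "nat list \<Rightarrow> (nat \<times> nat) set" where
  "diagram \<alpha> = {(i, j). i < length \<alpha> \<and> j < \<alpha> ! i}"

definition skew_diagram :: "nat list \<Rightarrow> nat list \<Rightarrow> (nat \<times> nat) set" where
  "skew_diagram \<alpha> \<beta> = diagram \<alpha> - diagram \<beta>"

type_synonym tableau = "nat \<times> nat \<Rightarrow> nat"

definition SIT :: "nat list \<Rightarrow> nat list \<Rightarrow> tableau set" where
  "SIT \<alpha> \<beta> = {T \<in> extensional (skew_diagram \<alpha> \<beta>).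
     bij_betw T (skew_diagram \<alpha> \<beta>) {1..sum_list \<alpha> - sum_list \<beta>} \<and>
     (\<forall>i i'. (i, 0) \<in> skew_diagram \<alpha> \<beta> \<longrightarrow> (i', 0) \<in> skew_diagram \<alpha> \<beta> \<longrightarrow> i < i' \<longrightarrow>
        T (i, 0) < T (i', 0)) \<and>
     (\<forall>i j j'. (i, j) \<in> skew_diagram \<alpha> \<beta> \<longrightarrow> (i, j') \<in> skew_diagram \<alpha> \<beta> \<longrightarrow> j < j' \<longrightarrow>
        T (i, j) < T (i, j'))}"

definition entry_row :: "(nat \<times> nat) set \<Rightarrow> tableau \<Rightarrow> nat \<Rightarrow> nat" where
  "entry_row D T k = fst (the_inv_into D T k)"

definition swap_entries :: "(nat \<times> nat) set \<Rightarrow> nat \<Rightarrow> tableau \<Rightarrow> tableau" where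
  "swap_entries D i T = (\<lambda>c\<in>D. transpose i (i + 1) (T c))"

definition pi_tableau :: "(nat \<times> nat) set \<Rightarrow> nat \<Rightarrow> tableau \<Rightarrow> (tableau \<Rightarrow>\<^sub>0 complex)" where
  "pi_tableau D i T =
     (if entry_row D T i < entry_row D T (i + 1) then Poly_Mapping.single T 1
      else if entry_row D T (i + 1) < entry_row D T i
        then Poly_Mapping.single (swap_entries D i T) 1
      else 0)"

definition scale :: "complex \<Rightarrow> ('x \<Rightarrow>\<^sub>0 complex) \<Rightarrow> ('x \<Rightarrow>\<^sub>0 complex)" where
  "scale c v = Poly_Mapping.map ((*) c) v"

definition linear_extension ::
    "('x \<Rightarrow> ('y \<Rightarrow>\<^sub>0 complex)) \<Rightarrow> ('x \<Rightarrow>\<^sub>0 complex) \<Rightarrow> ('y \<Rightarrow>\<^sub>0 complex)" where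
  "linear_extension g v =
     (\<Sum>x \<in> Poly_Mapping.keys v. scale (Poly_Mapping.lookup v x) (g x))"

definition free_action :: "(nat \<times> nat) set \<Rightarrow> free_elem \<Rightarrow>
    (tableau \<Rightarrow>\<^sub>0 complex) \<Rightarrow> (tableau \<Rightarrow>\<^sub>0 complex)" where
  "free_action D f v =
     (\<Sum>w \<in> Poly_Mapping.keys f.
        scale (Poly_Mapping.lookup f w) (foldr (\<lambda>i. linear_extension (pi_tableau D i)) w v))"

text \<open>The module $\mathcal{V}_{\alpha/\beta}$ over \<^term>\<open>hecke (sum_list \<alpha> - sum_list \<beta>)\<close>; an element of
  this algebra acts by any of its representatives in the free algebra.\<close>

definition tableau_module :: "nat list \<Rightarrow> nat list \<Rightarrow>
    (hecke_elem, tableau \<Rightarrow>\<^sub>0 complex) module" where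
  "tableau_module \<alpha> \<beta> =
     \<lparr>carrier = {v. Poly_Mapping.keys v \<subseteq> SIT \<alpha> \<beta>},
      monoid.mult = undefined, one = undefined, ring.zero = 0, ring.add = (+),
      module.smult = (\<lambda>x v. the_elem ((\<lambda>f. free_action (skew_diagram \<alpha> \<beta>) f v) ` x))\<rparr>"

end

theory Submission
  imports Defs
begin

text \<open>In a tableau of shape \<open>\<alpha>\<close> the cells with entries at most \<open>m\<close> form the diagram of a composition
  \<open>\<beta> \<subseteq> \<alpha>\<close> of \<open>m\<close>: the rows increase, and so does the first column, whence the nonempty rows are
  the lowest ones. Cutting there identifies the tableaux of shape \<open>\<alpha>\<close> with the pairs of a tableau
  of shape \<open>\<beta>\<close> and one of shape \<open>\<alpha>/\<beta>\<close>. A generator with index other than \<open>m\<close> acts on only one of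
  the two parts and hence preserves \<open>\<beta>\<close>, so the basis of the module splits into blocks that are the
  bases of the tensor products. The relations of the 0-Hecke algebra hold because each side of
  a relation sorts the rows of the entries concerned, and vanishes if two of these rows agree.\<close>

section \<open>Linear maps between spaces of finitely supported functions\<close>

text \<open>In the definitions every action is the single element of a set of candidates: one for
  each representative in the free algebra, for each preimage under an embedding, or for each way of
  writing an algebra element and a vector as sums of pure tensors. The main obstacle is that all
  candidates agree. For \<open>tableau_module\<close> this is the vanishing of the ideal on
  tableaux. For \<open>tensor_module\<close> and \<open>transport_embed\<close> the module of
  \<alpha> is the witness: gluing maps the candidates injectively into it, and the image depends
  only on the algebra element and the vector. For the same reason the isomorphism is built from the
  direct sum towards the module of \<alpha> and inverted at the end, and the module axioms of the
  sum are pulled back along it. The index \<open>m\<close> is exceptional because this generator may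
  exchange the entries \<open>m\<close> and \<open>m + 1\<close> across the cut. It is absent from
  the parabolic subalgebra, where the letters below \<open>m\<close> commute with those above, so
  that every element is a sum of products of a small and a large factor.\<close>

lemma lookup_scale [simp]: "Poly_Mapping.lookup (scale c v) x = c * Poly_Mapping.lookup v x"
  unfolding scale_def by (simp add: Poly_Mapping.map.rep_eq when_def)

lemma scale_simps [simp]:
  "scale c 0 = 0" "scale 0 v = 0" "scale 1 v = v" "scale c (scale d v) = scale (c * d) v"
  "scale c (Poly_Mapping.single x d) = Poly_Mapping.single x (c * d)"
  by (rule poly_mapping_eqI; simp add: lookup_single when_def)+

lemma scale_add_right: "scale c (v + w) = scale c v + scale c w"
  by (rule poly_mapping_eqI) (simp add: lookup_add ring_distribs)

lemma scale_add_left: "scale (c + d) v = scale c v + scale d v"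
  by (rule poly_mapping_eqI) (simp add: lookup_add ring_distribs)

lemma scale_sum_right: "scale c (sum g A) = (\<Sum>a\<in>A. scale c (g a))"
  by (rule poly_mapping_eqI) (simp add: lookup_sum sum_distrib_left)

lemma poly_mapping_sum_single: "(\<Sum>x\<in>Poly_Mapping.keys v. Poly_Mapping.single x (Poly_Mapping.lookup v x)) = v"
  by (rule poly_mapping_eqI)
     (auto simp: lookup_sum lookup_single when_def in_keys_iff sum.delta)

text \<open>A finitely supported function is the sum of its single terms. The zero function is
  itself a \<open>single\<close> with coefficient 0 and falls under the first case.\<close>

lemma poly_mapping_additive_induct [case_names single add]:
  fixes v :: "'a \<Rightarrow>\<^sub>0 'b :: comm_monoid_add"
  assumes "\<And>x c. P (Poly_Mapping.single x c)" and "\<And>f g. P f \<Longrightarrow> P g \<Longrightarrow> P (f + g)"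
  shows "P v"
proof -
  have "P (\<Sum>x\<in>A. Poly_Mapping.single x (Poly_Mapping.lookup v x))" if "finite A" for A
    using that
  proof induction
    case empty
    show ?case using assms(1)[of undefined 0] by simp
  qed (simp add: assms)
  then show ?thesis
    using poly_mapping_sum_single[of v] by (metis finite_keys)
qed

text \<open>Linearity on the whole function type: the maps are total, and a submodule enters only
  through a condition on the support, as in \<open>linear_op_eqI\<close>.\<close>

definition linear_op :: "(('x \<Rightarrow>\<^sub>0 complex) \<Rightarrow> ('y \<Rightarrow>\<^sub>0 complex)) \<Rightarrow> bool" where
  "linear_op F \<longleftrightarrow> (\<forall>v w. F (v + w) = F v + F w) \<and> (\<forall>c v. F (scale c v) = scale c (F v))"

lemma linear_opI:
  "(\<And>v w. F (v + w) = F v + F w) \<Longrightarrow> (\<And>c v. F (scale c v) = scale c (F v)) \<Longrightarrow> linear_op F"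
  by (simp add: linear_op_def)

lemma linear_op_add: "linear_op F \<Longrightarrow> F (v + w) = F v + F w"
  and linear_op_scale: "linear_op F \<Longrightarrow> F (scale c v) = scale c (F v)"
  by (simp_all add: linear_op_def)

lemma linear_op_0: "linear_op F \<Longrightarrow> F 0 = 0"
  using linear_op_scale[of F 0 0] by simp

lemma linear_op_diff: "linear_op F \<Longrightarrow> F (v - w) = F v - F w"
  using linear_op_add[of F "v - w" w] by (simp add: algebra_simps)

lemma linear_op_sum: "linear_op F \<Longrightarrow> F (sum g A) = (\<Sum>a\<in>A. F (g a))"
  by (induction A rule: infinite_finite_induct) (simp_all add: linear_op_0 linear_op_add)

lemma linear_op_comp: "linear_op F \<Longrightarrow> linear_op G \<Longrightarrow> linear_op (\<lambda>v. F (G v))"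
  by (simp add: linear_op_def)

lemma linear_op_id: "linear_op (\<lambda>v. v)"
  by (simp add: linear_op_def)

lemma linear_extension_add:
  "linear_extension g (v + w) = linear_extension g v + linear_extension g w"
  unfolding linear_extension_def
  by (rule setsum_keys_plus_distrib[where f = "\<lambda>x c. scale c (g x)"])
     (simp_all add: scale_add_left)

lemma linear_extension_single [simp]:
  "linear_extension g (Poly_Mapping.single x c) = scale c (g x)"
  by (simp add: linear_extension_def)

lemma linear_op_linear_extension: "linear_op (linear_extension g)"
proof (rule linear_opI)
  fix c v
  show "linear_extension g (scale c v) = scale c (linear_extension g v)"
    by (induction v rule: poly_mapping_additive_induct)
       (simp_all add: linear_extension_add scale_add_right)
qed (rule linear_extension_add)

lemmas linear_extension_0 [simp] = linear_op_0[OF linear_op_linear_extension]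

lemma keys_scale: "Poly_Mapping.keys (scale c v) \<subseteq> Poly_Mapping.keys v"
  by (auto simp: in_keys_iff)

lemma keys_linear_extension:
  assumes "\<And>x. x \<in> Poly_Mapping.keys v \<Longrightarrow> Poly_Mapping.keys (g x) \<subseteq> S"
  shows "Poly_Mapping.keys (linear_extension g v) \<subseteq> S"
  unfolding linear_extension_def
  using keys_sum[of "\<lambda>x. scale (Poly_Mapping.lookup v x) (g x)" "Poly_Mapping.keys v"] assms
    order_trans[OF keys_scale assms] by (meson UN_least order_trans)

lemma linear_op_expand:
  assumes "linear_op F"
  shows "F v = linear_extension (\<lambda>x. F (Poly_Mapping.single x 1)) v"
proof (induction v rule: poly_mapping_additive_induct)
  case (single x c)
  show ?case using linear_op_scale[OF assms, of c "Poly_Mapping.single x 1"] by simp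
qed (simp add: linear_extension_add linear_op_add[OF assms])

text \<open>A linear map is determined by its values on basis elements, and only those in the
  support of \<open>v\<close> matter. With \<open>S\<close> a set of tableaux, identities of
  operators become identities about single tableaux.\<close>

lemma linear_op_eqI:
  assumes "linear_op F" "linear_op G" "Poly_Mapping.keys v \<subseteq> S"
    and "\<And>x. x \<in> S \<Longrightarrow> F (Poly_Mapping.single x 1) = G (Poly_Mapping.single x 1)"
  shows "F v = G v"
  using assms(3,4)
  by (subst linear_op_expand[OF assms(1)], subst linear_op_expand[OF assms(2)])
     (auto simp: linear_extension_def intro!: sum.cong)

lemma linear_extension_fun_add:
  "linear_extension (\<lambda>x. g x + h x) v = linear_extension g v + linear_extension h v"
  by (simp add: linear_extension_def scale_add_right sum.distrib)

lemma linear_extension_fun_scale: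
  "linear_extension (\<lambda>x. scale c (g x)) v = scale c (linear_extension g v)"
  by (simp add: linear_extension_def scale_sum_right mult.commute)


section \<open>The free algebra and its quotient\<close>

lemma free_alg_simps [simp]:
  "f \<otimes>\<^bsub>free_alg N\<^esub> g = f * g" "\<one>\<^bsub>free_alg N\<^esub> = 1" "\<zero>\<^bsub>free_alg N\<^esub> = 0" "f \<oplus>\<^bsub>free_alg N\<^esub> g = f + g"
  by (simp_all add: free_alg_def)

text \<open>The span of the words over an arbitrary set of letters: \<open>{1..<N}\<close> gives
  \<open>free_alg N\<close>, and \<open>{1..<n} - {m}\<close> gives representatives for the
  parabolic subalgebra.\<close>

definition words_in :: "nat set \<Rightarrow> free_elem set" where
  "words_in J = {f. \<forall>w \<in> Poly_Mapping.keys f. set w \<subseteq> J}"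

lemma carrier_free_alg: "carrier (free_alg N) = words_in {1..<N}"
  by (simp add: free_alg_def words_in_def)

lemma words_in_add: "f \<in> words_in J \<Longrightarrow> g \<in> words_in J \<Longrightarrow> f + g \<in> words_in J"
  using Poly_Mapping.keys_add[of f g] by (auto simp: words_in_def)

lemma words_in_mult: "f \<in> words_in J \<Longrightarrow> g \<in> words_in J \<Longrightarrow> f * g \<in> words_in J"
  using keys_mult[of f g] by (fastforce simp: words_in_def plus_list_def)

lemma words_in_uminus: "f \<in> words_in J \<Longrightarrow> - f \<in> words_in J"
  by (simp add: words_in_def in_keys_iff)

lemma words_in_diff: "f \<in> words_in J \<Longrightarrow> g \<in> words_in J \<Longrightarrow> f - g \<in> words_in J"
  using words_in_add[of f J "- g"] words_in_uminus[of g J] by simp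

lemma words_in_single: "set w \<subseteq> J \<Longrightarrow> Poly_Mapping.single w c \<in> words_in J"
  by (auto simp: words_in_def)

lemma words_in_0: "0 \<in> words_in J"
  by (simp add: words_in_def)

lemma words_in_1: "1 \<in> words_in J"
  by (simp add: words_in_def zero_list_def)

lemma words_in_letter: "i \<in> J \<Longrightarrow> letter i \<in> words_in J"
  by (simp add: letter_def words_in_single)

lemma words_in_sum: "(\<And>k. k \<in> K \<Longrightarrow> h k \<in> words_in J) \<Longrightarrow> sum h K \<in> words_in J"
  by (induction K rule: infinite_finite_induct) (simp_all add: words_in_0 words_in_add)

lemmas words_in_closed = words_in_add words_in_mult words_in_uminus words_in_diff words_in_single
  words_in_0 words_in_1 words_in_letter

lemmas free_alg_closed = words_in_closed[where J = "{1..<N}" for N, folded carrier_free_alg]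

lemma ring_free_alg: "ring (free_alg N)"
proof (rule ringI)
  show "abelian_group (free_alg N)"
  proof (rule abelian_groupI)
    fix x assume "x \<in> carrier (free_alg N)"
    then show "\<exists>y\<in>carrier (free_alg N). y \<oplus>\<^bsub>free_alg N\<^esub> x = \<zero>\<^bsub>free_alg N\<^esub>"
      by (intro bexI[of _ "- x"]) (simp_all add: free_alg_closed)
  qed (simp_all add: free_alg_closed algebra_simps)
  show "Group.monoid (free_alg N)"
    by (rule monoidI) (simp_all add: free_alg_closed mult.assoc)
qed (simp_all add: ring_distribs)

lemma free_alg_a_minus:
  assumes "f \<in> carrier (free_alg N)" "g \<in> carrier (free_alg N)"
  shows "\<ominus>\<^bsub>free_alg N\<^esub> f = - f" "f \<ominus>\<^bsub>free_alg N\<^esub> g = f - g"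
proof -
  interpret ring "free_alg N" by (rule ring_free_alg)
  have neg: "\<ominus>\<^bsub>free_alg N\<^esub> h = - h" if "h \<in> carrier (free_alg N)" for h
    by (rule minus_equality) (use that free_alg_closed in simp_all)
  from neg assms show "\<ominus>\<^bsub>free_alg N\<^esub> f = - f" by simp
  from neg assms show "f \<ominus>\<^bsub>free_alg N\<^esub> g = f - g" by (simp add: a_minus_def)
qed

lemma hecke_relations_cases [consumes 1, case_names idem braid comm]:
  assumes "h \<in> hecke_relations N"
  obtains i where "h = letter i * letter i - letter i" "i \<in> {1..<N}"
    | i where "h = letter i * letter (i + 1) * letter i - letter (i + 1) * letter i * letter (i + 1)"
        "i \<in> {1..<N}" "i + 1 \<in> {1..<N}"
    | i j where "h = letter i * letter j - letter j * letter i"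
        "i \<in> {1..<N}" "j \<in> {1..<N}" "\<bar>int i - int j\<bar> \<ge> 2"
  using assms unfolding hecke_relations_def by blast

lemma hecke_relations_closed: "hecke_relations N \<subseteq> carrier (free_alg N)"
  unfolding hecke_relations_def by (auto intro!: free_alg_closed)

lemma ideal_hecke_ideal: "ideal (hecke_ideal N) (free_alg N)"
  unfolding hecke_ideal_def
  by (rule ring.genideal_ideal[OF ring_free_alg hecke_relations_closed])

lemma hecke_relations_ideal: "hecke_relations N \<subseteq> hecke_ideal N"
  unfolding hecke_ideal_def by (rule ring.genideal_self[OF ring_free_alg hecke_relations_closed])

lemma ring_hecke: "ring (hecke N)"
  unfolding hecke_def by (rule ideal.quotient_is_ring[OF ideal_hecke_ideal])

lemma hecke_class_altdef: "hecke_class N f = {h + f | h. h \<in> hecke_ideal N}"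
  by (auto simp: hecke_class_def a_r_coset_def')

lemma hecke_class_hom: "hecke_class N \<in> ring_hom (free_alg N) (hecke N)"
  using ideal.rcos_ring_hom[OF ideal_hecke_ideal, of N] by (simp add: hecke_def hecke_class_def[abs_def])

lemmas hecke_class_mult = ring_hom_mult[OF hecke_class_hom, unfolded free_alg_simps]
  and hecke_class_add = ring_hom_add[OF hecke_class_hom, unfolded free_alg_simps]
  and hecke_class_one = ring_hom_one[OF hecke_class_hom, unfolded free_alg_simps]
  and hecke_class_closed = ring_hom_closed[OF hecke_class_hom]

lemma hecke_class_zero: "hecke_class N 0 = \<zero>\<^bsub>hecke N\<^esub>"
  using ring_hom_zero[OF hecke_class_hom ring_free_alg ring_hecke] by simp

lemma carrier_hecke: "carrier (hecke N) = hecke_class N ` carrier (free_alg N)"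
  by (auto simp: hecke_def hecke_class_def FactRing_def A_RCOSETS_def')

lemma hecke_class_uminus:
  assumes "f \<in> carrier (free_alg N)"
  shows "hecke_class N (- f) = \<ominus>\<^bsub>hecke N\<^esub> hecke_class N f"
proof -
  interpret ring "hecke N" by (rule ring_hecke)
  show ?thesis
    using assms hecke_class_add[of "- f" N f]
    by (intro minus_equality[symmetric])
       (simp_all add: hecke_class_closed free_alg_closed hecke_class_zero)
qed

lemma hecke_class_eqI:
  assumes "f - g \<in> hecke_ideal N" "g \<in> carrier (free_alg N)"
  shows "hecke_class N f = hecke_class N g"
proof -
  interpret I: ideal "hecke_ideal N" "free_alg N" by (rule ideal_hecke_ideal)
  have "f \<in> hecke_class N g" using assms(1) by (force simp: hecke_class_altdef)
  then show ?thesis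
    using I.a_repr_independence[OF _ assms(2) I.a_subgroup] unfolding hecke_class_def by simp
qed

text \<open>Invariance under adding elements of the ideal makes the image of the coset a singleton.
  This is the common criterion for \<open>hecke_embed\<close> and for the action on tableaux, both
  of which are defined by \<open>the_elem\<close>.\<close>

lemma the_elem_image_hecke_class:
  assumes "f \<in> carrier (free_alg N)" and "\<And>h. h \<in> hecke_ideal N \<Longrightarrow> \<phi> (h + f) = \<phi> f"
  shows "the_elem (\<phi> ` hecke_class N f) = \<phi> f"
proof -
  have "0 \<in> hecke_ideal N"
    using additive_subgroup.zero_closed[OF ideal.axioms(1)[OF ideal_hecke_ideal]] by simp
  then have "\<phi> ` hecke_class N f = {\<phi> f}"
    using assms(2) by (force simp: hecke_class_altdef)
  then show ?thesis by simp
qed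

section \<open>Shifting letters and the induced maps between the algebras\<close>

lemma shift_letters_altdef:
  "shift_letters k = linear_extension (\<lambda>w. Poly_Mapping.single (map (\<lambda>i. i + k) w) 1)"
  by (rule ext) (simp add: shift_letters_def linear_extension_def)

lemma linear_op_shift_letters: "linear_op (shift_letters k)"
  by (simp add: shift_letters_altdef linear_op_linear_extension)

lemma shift_letters_single [simp]:
  "shift_letters k (Poly_Mapping.single w c) = Poly_Mapping.single (map (\<lambda>i. i + k) w) c"
  by (simp add: shift_letters_altdef)

lemma shift_letters_0 [simp]: "shift_letters 0 f = f"
  by (simp add: shift_letters_def poly_mapping_sum_single)

lemmas shift_letters_add = linear_op_add[OF linear_op_shift_letters]
  and shift_letters_diff = linear_op_diff[OF linear_op_shift_letters]

lemma shift_letters_mult: "shift_letters k (f * g) = shift_letters k f * shift_letters k g"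
proof (induction f rule: poly_mapping_additive_induct)
  case (single x d)
  show ?case
    by (induction g rule: poly_mapping_additive_induct)
       (simp_all add: mult_single distrib_left shift_letters_add plus_list_def)
qed (simp add: distrib_right shift_letters_add)

lemma shift_letters_letter: "shift_letters k (letter i) = letter (i + k)"
  by (simp add: letter_def)

lemma shift_letters_closed:
  assumes "f \<in> carrier (free_alg N)" "N + k \<le> N'"
  shows "shift_letters k f \<in> carrier (free_alg N')"
proof -
  have "Poly_Mapping.keys (shift_letters k f) \<subseteq> {w. set w \<subseteq> {1..<N'}}"
    unfolding shift_letters_altdef
    by (rule keys_linear_extension)
       (use assms in \<open>fastforce simp: carrier_free_alg words_in_def\<close>)
  then show ?thesis by (auto simp: carrier_free_alg words_in_def)
qed

text \<open>Shifting preserves the relations, so the preimage of the ideal is an ideal that contains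
  them.\<close>

lemma shift_letters_ideal:
  assumes "N + k \<le> N'" "h \<in> hecke_ideal N"
  shows "shift_letters k h \<in> hecke_ideal N'"
proof -
  have "(1 :: free_elem) = Poly_Mapping.single [] 1"
    by (simp flip: zero_list_def)
  then have "shift_letters k 1 = 1" by (metis shift_letters_single list.simps(8))
  then have hom: "shift_letters k \<in> ring_hom (free_alg N) (free_alg N')"
    by (intro ring_hom_memI)
       (simp_all add: shift_letters_closed[OF _ assms(1)] shift_letters_mult shift_letters_add)
  then have "ring_hom_ring (free_alg N) (free_alg N') (shift_letters k)"
    by (intro ring_hom_ringI2 ring_free_alg)
  then have "ideal {h \<in> carrier (free_alg N). shift_letters k h \<in> hecke_ideal N'} (free_alg N)"
    by (rule ring_hom_ring.ideal_vimage) (rule ideal_hecke_ideal)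
  moreover have "shift_letters k h \<in> hecke_relations N'" if "h \<in> hecke_relations N" for h
  proof -
    from that show ?thesis
    proof (cases rule: hecke_relations_cases)
      case (idem i)
      then have "i + k \<in> {1..<N'}" using assms(1) by auto
      with idem show ?thesis
        unfolding hecke_relations_def
        by (auto simp: shift_letters_diff shift_letters_mult shift_letters_letter)
    next
      case (braid i)
      then have "i + k \<in> {1..<N'}" "i + k + 1 \<in> {1..<N'}" using assms(1) by auto
      moreover have "shift_letters k h = letter (i + k) * letter (i + k + 1) * letter (i + k)
          - letter (i + k + 1) * letter (i + k) * letter (i + k + 1)"
        using braid by (simp add: shift_letters_diff shift_letters_mult shift_letters_letter)
      ultimately show ?thesis
        unfolding hecke_relations_def by blast
    next
      case (comm i j)
      then have "i + k \<in> {1..<N'}" "j + k \<in> {1..<N'}" "\<bar>int (i + k) - int (j + k)\<bar> \<ge> 2"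
        using assms(1) by auto
      moreover have "shift_letters k h = letter (i + k) * letter (j + k) - letter (j + k) * letter (i + k)"
        using comm by (simp add: shift_letters_diff shift_letters_mult shift_letters_letter)
      ultimately show ?thesis
        unfolding hecke_relations_def by blast
    qed
  qed
  ultimately have "hecke_ideal N \<subseteq> {h \<in> carrier (free_alg N). shift_letters k h \<in> hecke_ideal N'}"
    unfolding hecke_ideal_def[of N] using hecke_relations_closed hecke_relations_ideal
    by (intro ring.genideal_minimal[OF ring_free_alg]) blast+
  with assms(2) show ?thesis by blast
qed

lemma hecke_embed_class:
  assumes "N + k \<le> N'" "f \<in> carrier (free_alg N)"
  shows "hecke_embed k N N' (hecke_class N f) = hecke_class N' (shift_letters k f)"
  unfolding hecke_embed_def
proof (rule the_elem_image_hecke_class[OF assms(2)])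
  fix h assume "h \<in> hecke_ideal N"
  then show "hecke_class N' (shift_letters k (h + f)) = hecke_class N' (shift_letters k f)"
    using assms by (intro hecke_class_eqI)
      (simp_all add: shift_letters_add shift_letters_ideal shift_letters_closed)
qed


section \<open>Direct sums\<close>

text \<open>The map is given from \<open>N\<close> to \<open>M\<close>, and \<open>N\<close> is not
  known beforehand to be a group or a module: its axioms are pulled back from those of
  \<open>M\<close> along the injection \<psi>. Surjectivity provides the negatives.\<close>

lemma module_isomorphicI_inverse:
  assumes M: "left_module R M" and bij: "bij_betw \<psi> (carrier N) (carrier M)"
    and add: "\<And>x y. x \<in> carrier N \<Longrightarrow> y \<in> carrier N \<Longrightarrow>
      x \<oplus>\<^bsub>N\<^esub> y \<in> carrier N \<and> \<psi> (x \<oplus>\<^bsub>N\<^esub> y) = \<psi> x \<oplus>\<^bsub>M\<^esub> \<psi> y"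
    and zero: "\<zero>\<^bsub>N\<^esub> \<in> carrier N" "\<psi> \<zero>\<^bsub>N\<^esub> = \<zero>\<^bsub>M\<^esub>"
    and smult: "\<And>a x. a \<in> carrier R \<Longrightarrow> x \<in> carrier N \<Longrightarrow>
      a \<odot>\<^bsub>N\<^esub> x \<in> carrier N \<and> \<psi> (a \<odot>\<^bsub>N\<^esub> x) = a \<odot>\<^bsub>M\<^esub> \<psi> x"
  shows "module_isomorphic R M N"
proof -
  interpret M: left_module R M by (rule M)
  have mem: "\<psi> x \<in> carrier M" if "x \<in> carrier N" for x
    using bij that by (auto simp: bij_betw_def)
  have eqI: "x = y" if "\<psi> x = \<psi> y" "x \<in> carrier N" "y \<in> carrier N" for x y
    using bij that by (auto simp: bij_betw_def inj_on_def)
  have "abelian_group N"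
  proof (rule abelian_groupI)
    fix x assume x: "x \<in> carrier N"
    have "\<ominus>\<^bsub>M\<^esub> \<psi> x \<in> \<psi> ` carrier N"
      using x mem bij by (auto simp: bij_betw_def)
    then obtain y where y: "y \<in> carrier N" "\<psi> y = \<ominus>\<^bsub>M\<^esub> \<psi> x" by auto
    then have "y \<oplus>\<^bsub>N\<^esub> x = \<zero>\<^bsub>N\<^esub>"
      using x zero add mem by (intro eqI) (simp_all add: M.l_neg)
    with y show "\<exists>y\<in>carrier N. y \<oplus>\<^bsub>N\<^esub> x = \<zero>\<^bsub>N\<^esub>" by blast
  qed (use zero add mem in \<open>auto intro!: eqI simp: M.M.a_ac\<close>)
  then have N: "left_module R N"
    unfolding left_module_def left_module_axioms_def
    using smult add mem
    by (auto intro!: eqI M.ring_axioms simp: M.smult_closed M.smult_l_distr M.smult_r_distr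
        M.smult_assoc M.smult_one)
  let ?\<phi> = "the_inv_into (carrier N) \<psi>"
  have inj: "inj_on \<psi> (carrier N)" using bij by (simp add: bij_betw_def)
  have inv: "?\<phi> (\<psi> x) = x" if "x \<in> carrier N" for x
    by (rule the_inv_into_f_f[OF inj that])
  have surj: "\<exists>x'\<in>carrier N. x = \<psi> x'" if "x \<in> carrier M" for x
    using bij that by (auto simp: bij_betw_def)
  have "?\<phi> \<in> iso (add_monoid M) (add_monoid N)"
  proof (rule isoI)
    show "?\<phi> \<in> hom (add_monoid M) (add_monoid N)"
    proof (rule homI)
      fix x assume "x \<in> carrier (add_monoid M)"
      then show "?\<phi> x \<in> carrier (add_monoid N)" using surj[of x] by (auto simp: inv)
    next
      fix x y assume "x \<in> carrier (add_monoid M)" "y \<in> carrier (add_monoid M)"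
      then obtain x' y' where "x' \<in> carrier N" "y' \<in> carrier N" "x = \<psi> x'" "y = \<psi> y'"
        using surj[of x] surj[of y] by auto
      then show "?\<phi> (x \<otimes>\<^bsub>add_monoid M\<^esub> y) = ?\<phi> x \<otimes>\<^bsub>add_monoid N\<^esub> ?\<phi> y"
        using add[of x' y'] inv[of "x' \<oplus>\<^bsub>N\<^esub> y'"] by (simp add: inv)
    qed
    show "bij_betw ?\<phi> (carrier (add_monoid M)) (carrier (add_monoid N))"
      using bij_betw_the_inv_into[OF bij] by simp
  qed
  moreover have "?\<phi> (a \<odot>\<^bsub>M\<^esub> x) = a \<odot>\<^bsub>N\<^esub> ?\<phi> x" if a: "a \<in> carrier R" and x: "x \<in> carrier M" for a x
  proof -
    obtain x' where "x' \<in> carrier N" "x = \<psi> x'" using surj[OF x] by blast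
    then show ?thesis using smult[OF a, of x'] inv[of "a \<odot>\<^bsub>N\<^esub> x'"] by (simp add: inv)
  qed
  ultimately show ?thesis
    unfolding module_isomorphic_def using M N by blast
qed

section \<open>Renaming basis elements and splitting a module along a partition of its basis\<close>

definition relabel :: "('x \<Rightarrow> 'y) \<Rightarrow> ('x \<Rightarrow>\<^sub>0 complex) \<Rightarrow> ('y \<Rightarrow>\<^sub>0 complex)" where
  "relabel g = linear_extension (\<lambda>x. Poly_Mapping.single (g x) 1)"

lemma linear_op_relabel: "linear_op (relabel g)"
  unfolding relabel_def by (rule linear_op_linear_extension)

lemma relabel_single [simp]: "relabel g (Poly_Mapping.single x c) = Poly_Mapping.single (g x) c"
  by (simp add: relabel_def)

lemma keys_relabel: "Poly_Mapping.keys (relabel g v) \<subseteq> g ` Poly_Mapping.keys v"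
  unfolding relabel_def by (rule keys_linear_extension) auto

text \<open>Coefficients add up where \<open>g\<close> identifies basis elements, so they can be
  read off only where \<open>g\<close> is injective. This is asked on a set that contains the
  support because gluing is injective on tableaux only.\<close>

lemma lookup_relabel:
  assumes "inj_on g T" "Poly_Mapping.keys v \<subseteq> T" "t \<in> T"
  shows "Poly_Mapping.lookup (relabel g v) (g t) = Poly_Mapping.lookup v t"
proof -
  have "Poly_Mapping.lookup (relabel g v) (g t) =
      (\<Sum>x\<in>Poly_Mapping.keys v. Poly_Mapping.lookup v x * (1 when g x = g t))"
    by (simp add: relabel_def linear_extension_def lookup_sum lookup_single mult_when)
  also have "\<dots> = (\<Sum>x\<in>Poly_Mapping.keys v. if x = t then Poly_Mapping.lookup v x else 0)"
    using assms by (intro sum.cong) (auto simp: inj_on_def when_def)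
  finally show ?thesis by (simp add: in_keys_iff)
qed

lemma relabel_inj:
  assumes "inj_on g T" "Poly_Mapping.keys v \<subseteq> T" "Poly_Mapping.keys w \<subseteq> T"
    and "relabel g v = relabel g w"
  shows "v = w"
proof (rule poly_mapping_eqI)
  fix t
  show "Poly_Mapping.lookup v t = Poly_Mapping.lookup w t"
  proof (cases "t \<in> T")
    case True
    then show ?thesis
      using lookup_relabel[OF assms(1,2), of t] lookup_relabel[OF assms(1,3), of t] assms(4) by simp
  next
    case False
    then have "t \<notin> Poly_Mapping.keys v" "t \<notin> Poly_Mapping.keys w" using assms by auto
    then show ?thesis by (simp add: in_keys_iff)
  qed
qed

lemma left_module_smult_sum:
  fixes V :: "('a, 'b :: ab_group_add) module"
  assumes "left_module R V" "\<And>x y. x \<oplus>\<^bsub>V\<^esub> y = x + y" "\<zero>\<^bsub>V\<^esub> = 0"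
    and "a \<in> carrier R" "\<And>i. i \<in> A \<Longrightarrow> h i \<in> carrier V"
  shows "a \<odot>\<^bsub>V\<^esub> sum h A = (\<Sum>i\<in>A. a \<odot>\<^bsub>V\<^esub> h i)"
proof -
  interpret V: left_module R V by (rule assms(1))
  have zero: "a \<odot>\<^bsub>V\<^esub> 0 = 0"
    using V.smult_r_distr[OF assms(4), of 0 0] V.M.zero_closed assms by simp
  have "sum h A \<in> carrier V \<and> a \<odot>\<^bsub>V\<^esub> sum h A = (\<Sum>i\<in>A. a \<odot>\<^bsub>V\<^esub> h i)"
    using assms(5)
  proof (induction A rule: infinite_finite_induct)
    case (insert x F)
    then show ?case
      using V.smult_r_distr[OF assms(4), of "h x" "sum h F"] V.M.add.m_closed[of "h x" "sum h F"]
      by (simp add: assms(2))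
  qed (use zero V.M.zero_closed assms(3) in simp_all)
  then show ?thesis by blast
qed

text \<open>The images of the sets \<open>T i\<close> under \<open>g i\<close> partition the basis
  \<open>S\<close> of \<open>V\<close>, and each relabelling along \<open>g i\<close> respects the
  action; the sum of the relabellings is then the isomorphism. The module axioms of the direct sum
  are obtained here rather than assumed.\<close>

lemma module_isomorphic_direct_sum:
  fixes V :: "('a, 'x \<Rightarrow>\<^sub>0 complex) module" and M :: "'i \<Rightarrow> ('a, 'y \<Rightarrow>\<^sub>0 complex) module"
  assumes V: "left_module R V" "carrier V = {v. Poly_Mapping.keys v \<subseteq> S}"
      "\<And>x y. x \<oplus>\<^bsub>V\<^esub> y = x + y" "\<zero>\<^bsub>V\<^esub> = 0"
    and I: "finite I"
    and M: "\<And>i. i \<in> I \<Longrightarrow> carrier (M i) = {v. Poly_Mapping.keys v \<subseteq> T i}"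
      "\<And>i x y. i \<in> I \<Longrightarrow> x \<oplus>\<^bsub>M i\<^esub> y = x + y" "\<And>i. i \<in> I \<Longrightarrow> \<zero>\<^bsub>M i\<^esub> = 0"
    and bij: "bij_betw (\<lambda>(i, t). g i t) (SIGMA i:I. T i) S"
    and smult: "\<And>i a v. i \<in> I \<Longrightarrow> a \<in> carrier R \<Longrightarrow> v \<in> carrier (M i) \<Longrightarrow>
      a \<odot>\<^bsub>M i\<^esub> v \<in> carrier (M i) \<and> relabel (g i) (a \<odot>\<^bsub>M i\<^esub> v) = a \<odot>\<^bsub>V\<^esub> relabel (g i) v"
  shows "module_isomorphic R V (direct_sum I M)"
proof -
  define \<psi> where "\<psi> f = (\<Sum>i\<in>I. relabel (g i) (f i))" for f
  have car: "carrier (direct_sum I M) = (\<Pi>\<^sub>E i\<in>I. {v. Poly_Mapping.keys v \<subseteq> T i})"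
    using I M(1) by (auto simp: direct_sum_def PiE_iff extensional_def)
  have inj: "inj_on (g i) (T i)" if "i \<in> I" for i
    using bij that by (force simp: bij_betw_def inj_on_def)
  have g_eq: "i = j \<and> t = u" if "g i t = g j u" "i \<in> I" "j \<in> I" "t \<in> T i" "u \<in> T j" for i j t u
    using bij that by (force simp: bij_betw_def inj_on_def)
  have g_S: "g i t \<in> S" if "i \<in> I" "t \<in> T i" for i t
    using bij that by (force simp: bij_betw_def)
  have keys_rel: "Poly_Mapping.keys (relabel (g i) v) \<subseteq> g i ` T i" if "Poly_Mapping.keys v \<subseteq> T i" for i v
    using keys_relabel[of "g i" v] that by blast
  have lookup_\<psi>: "Poly_Mapping.lookup (\<psi> f) (g i t) = Poly_Mapping.lookup (f i) t"
    if f: "\<And>j. j \<in> I \<Longrightarrow> Poly_Mapping.keys (f j) \<subseteq> T j" and i: "i \<in> I" "t \<in> T i" for f i t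
  proof -
    \<comment> \<open>The blocks are disjoint, so only the summand with index \<open>i\<close> sees
      the basis element \<open>g i t\<close>.\<close>
    have "Poly_Mapping.lookup (relabel (g j) (f j)) (g i t) = 0" if "j \<in> I" "j \<noteq> i" for j
    proof -
      have "g i t \<notin> g j ` T j" using g_eq i that by blast
      then show ?thesis using keys_rel[OF f[OF that(1)]] by (auto simp: in_keys_iff)
    qed
    then have "Poly_Mapping.lookup (\<psi> f) (g i t) =
        (\<Sum>j\<in>I. if j = i then Poly_Mapping.lookup (relabel (g i) (f i)) (g i t) else 0)"
      by (simp add: \<psi>_def lookup_sum cong: if_cong) (intro sum.cong, auto)
    also have "\<dots> = Poly_Mapping.lookup (f i) t"
      using I i lookup_relabel[OF inj f] by simp
    finally show ?thesis .
  qed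
  have keys_\<psi>: "Poly_Mapping.keys (\<psi> f) \<subseteq> S"
    if "\<And>j. j \<in> I \<Longrightarrow> Poly_Mapping.keys (f j) \<subseteq> T j" for f
  proof -
    have "Poly_Mapping.keys (\<psi> f) \<subseteq> (\<Union>i\<in>I. Poly_Mapping.keys (relabel (g i) (f i)))"
      unfolding \<psi>_def by (rule keys_sum)
    also have "\<dots> \<subseteq> S" using keys_rel[OF that] g_S by fast
    finally show ?thesis .
  qed
  show ?thesis
  proof (rule module_isomorphicI_inverse[OF V(1), of \<psi>])
    show "bij_betw \<psi> (carrier (direct_sum I M)) (carrier V)"
      unfolding bij_betw_def
    proof (intro conjI equalityI subsetI)
      show "inj_on \<psi> (carrier (direct_sum I M))"
      proof (rule inj_onI)
        fix f h assume fh: "f \<in> carrier (direct_sum I M)" "h \<in> carrier (direct_sum I M)" "\<psi> f = \<psi> h"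
        show "f = h"
        proof (rule PiE_ext[OF fh(1,2)[unfolded car]], rule poly_mapping_eqI)
          fix i t assume i: "i \<in> I"
          have k: "Poly_Mapping.keys (f j) \<subseteq> T j" "Poly_Mapping.keys (h j) \<subseteq> T j" if "j \<in> I" for j
            using fh that unfolding car by auto
          show "Poly_Mapping.lookup (f i) t = Poly_Mapping.lookup (h i) t"
          proof (cases "t \<in> T i")
            case True
            then show ?thesis using lookup_\<psi>[of f i t] lookup_\<psi>[of h i t] k i fh(3) by simp
          next
            case False
            then have "t \<notin> Poly_Mapping.keys (f i)" "t \<notin> Poly_Mapping.keys (h i)" using k i by blast+
            then show ?thesis by (simp add: in_keys_iff)
          qed
        qed
      qed
    next
      fix v assume "v \<in> \<psi> ` carrier (direct_sum I M)"
      then show "v \<in> carrier V" using keys_\<psi> by (force simp: car V(2))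
    next
      fix v assume "v \<in> carrier V"
      then have v: "Poly_Mapping.keys v \<subseteq> S" by (simp add: V(2))
      \<comment> \<open>\<open>K i\<close> is the part of the support of \<open>v\<close> that lies
        in block \<open>i\<close>, seen in \<open>T i\<close>; \<open>f i\<close> is
        \<open>v\<close> pulled back to that block.\<close>
      define K where "K i = {t \<in> T i. g i t \<in> Poly_Mapping.keys v}" for i
      define f where "f = (\<lambda>i\<in>I. \<Sum>t\<in>K i. Poly_Mapping.single t (Poly_Mapping.lookup v (g i t)))"
      have fin: "finite (K i)" if "i \<in> I" for i
        unfolding K_def using finite_vimage_IntI[OF finite_keys inj[OF that], of v]
        by (rule rev_finite_subset) auto
      have f_lookup: "Poly_Mapping.lookup (f i) t = Poly_Mapping.lookup v (g i t)"
        if "i \<in> I" "t \<in> T i" for i t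
        using that fin[OF that(1)]
        by (auto simp: f_def lookup_sum lookup_single when_def K_def in_keys_iff)
      have f_keys: "Poly_Mapping.keys (f i) \<subseteq> T i" if "i \<in> I" for i
        using that keys_sum[of "\<lambda>t. Poly_Mapping.single t (Poly_Mapping.lookup v (g i t))" "K i"]
        by (auto simp: f_def K_def split: if_splits)
      have "\<psi> f = v"
      proof (rule poly_mapping_eqI)
        fix x
        show "Poly_Mapping.lookup (\<psi> f) x = Poly_Mapping.lookup v x"
        proof (cases "x \<in> S")
          case True
          then obtain i t where "i \<in> I" "t \<in> T i" "x = g i t"
            using bij by (auto simp: bij_betw_def)
          then show ?thesis using lookup_\<psi>[OF f_keys] f_lookup by simp
        next
          case False
          then have "x \<notin> Poly_Mapping.keys (\<psi> f)" "x \<notin> Poly_Mapping.keys v"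
            using v keys_\<psi>[OF f_keys] by blast+
          then show ?thesis by (simp add: in_keys_iff)
        qed
      qed
      moreover have "f \<in> carrier (direct_sum I M)"
        using f_keys by (auto simp: car f_def)
      ultimately show "v \<in> \<psi> ` carrier (direct_sum I M)" by blast
    qed
  next
    fix f h assume fh: "f \<in> carrier (direct_sum I M)" "h \<in> carrier (direct_sum I M)"
    have sum: "f \<oplus>\<^bsub>direct_sum I M\<^esub> h = (\<lambda>i\<in>I. f i + h i)"
      by (auto simp: direct_sum_def M(2))
    show "f \<oplus>\<^bsub>direct_sum I M\<^esub> h \<in> carrier (direct_sum I M) \<and>
        \<psi> (f \<oplus>\<^bsub>direct_sum I M\<^esub> h) = \<psi> f \<oplus>\<^bsub>V\<^esub> \<psi> h"
      unfolding sum V(3)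
    proof
      show "(\<lambda>i\<in>I. f i + h i) \<in> carrier (direct_sum I M)"
        using fh Poly_Mapping.keys_add unfolding car by fastforce
      show "\<psi> (\<lambda>i\<in>I. f i + h i) = \<psi> f + \<psi> h"
        by (simp add: \<psi>_def linear_op_add[OF linear_op_relabel] sum.distrib)
    qed
  next
    have zero: "\<zero>\<^bsub>direct_sum I M\<^esub> = (\<lambda>i\<in>I. 0)"
      by (auto simp: direct_sum_def M(3))
    show "\<zero>\<^bsub>direct_sum I M\<^esub> \<in> carrier (direct_sum I M)"
      unfolding zero car by auto
    show "\<psi> \<zero>\<^bsub>direct_sum I M\<^esub> = \<zero>\<^bsub>V\<^esub>"
      unfolding zero by (simp add: \<psi>_def linear_op_0[OF linear_op_relabel] V(4))
  next
    fix a f assume a: "a \<in> carrier R" and f: "f \<in> carrier (direct_sum I M)"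
    have prod: "a \<odot>\<^bsub>direct_sum I M\<^esub> f = (\<lambda>i\<in>I. a \<odot>\<^bsub>M i\<^esub> f i)"
      by (simp add: direct_sum_def)
    have f_mem: "f i \<in> carrier (M i)" if "i \<in> I" for i
      using f that M(1)[OF that] unfolding car by auto
    have "relabel (g i) (f i) \<in> carrier V" if "i \<in> I" for i
      using keys_rel[of "f i" i] f_mem[OF that] M(1)[OF that] g_S[OF that] by (auto simp: V(2))
    then have "\<psi> (\<lambda>i\<in>I. a \<odot>\<^bsub>M i\<^esub> f i) = a \<odot>\<^bsub>V\<^esub> \<psi> f"
      unfolding \<psi>_def using smult[OF _ a f_mem]
      by (subst left_module_smult_sum[OF V(1) V(3,4) a]) auto
    moreover have "(\<lambda>i\<in>I. a \<odot>\<^bsub>M i\<^esub> f i) \<in> carrier (direct_sum I M)"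
      using smult[OF _ a f_mem] M(1) unfolding car by auto
    ultimately show "a \<odot>\<^bsub>direct_sum I M\<^esub> f \<in> carrier (direct_sum I M) \<and>
        \<psi> (a \<odot>\<^bsub>direct_sum I M\<^esub> f) = a \<odot>\<^bsub>V\<^esub> \<psi> f"
      unfolding prod by blast
  qed
qed

lemma left_module_subring:
  assumes "left_module R M" "subring K R"
  shows "left_module (R\<lparr>carrier := K\<rparr>) M"
proof -
  interpret left_module R M by (rule assms(1))
  have "a \<in> carrier R" if "a \<in> K" for a
    using subringE(1)[OF assms(2)] that by blast
  then show ?thesis
    unfolding left_module_def left_module_axioms_def
    using R.subring_is_ring[OF assms(2)] M.abelian_group_axioms
    by (simp add: smult_closed smult_l_distr smult_r_distr smult_assoc smult_one)
qed


section \<open>Tableau modules\<close>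

abbreviation letter_op :: "(nat \<times> nat) set \<Rightarrow> nat \<Rightarrow> (tableau \<Rightarrow>\<^sub>0 complex) \<Rightarrow> (tableau \<Rightarrow>\<^sub>0 complex)" where
  "letter_op D i \<equiv> linear_extension (pi_tableau D i)"

definition word_op :: "(nat \<times> nat) set \<Rightarrow> nat list \<Rightarrow> (tableau \<Rightarrow>\<^sub>0 complex) \<Rightarrow> (tableau \<Rightarrow>\<^sub>0 complex)" where
  "word_op D = foldr (letter_op D)"

lemma word_op_simps [simp]:
  "word_op D [] v = v" "word_op D (i # w) v = letter_op D i (word_op D w v)"
  "word_op D (w @ w') v = word_op D w (word_op D w' v)"
  by (simp_all add: word_op_def)

lemma linear_op_word_op: "linear_op (word_op D w)"
proof (induction w)
  case (Cons i w)
  show ?case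
    using linear_op_comp[OF linear_op_linear_extension Cons.IH] by (simp add: linear_op_def)
qed (simp add: linear_op_def)

lemma free_action_altdef: "free_action D f v = linear_extension (\<lambda>w. word_op D w v) f"
  by (simp add: free_action_def linear_extension_def word_op_def)

lemma free_action_single [simp]: "free_action D (Poly_Mapping.single w c) v = scale c (word_op D w v)"
  by (simp add: free_action_altdef)

lemma linear_op_free_action_left: "linear_op (\<lambda>f. free_action D f v)"
  using linear_op_linear_extension by (simp add: free_action_altdef)

lemmas free_action_add_left = linear_op_add[OF linear_op_free_action_left]
  and free_action_diff_left = linear_op_diff[OF linear_op_free_action_left]
  and free_action_0_left [simp] = linear_op_0[OF linear_op_free_action_left]

lemma linear_op_free_action: "linear_op (free_action D f)"
proof (rule linear_opI)
  fix v w
  show "free_action D f (v + w) = free_action D f v + free_action D f w"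
    by (simp add: free_action_altdef linear_op_add[OF linear_op_word_op] linear_extension_fun_add)
next
  fix c v
  show "free_action D f (scale c v) = scale c (free_action D f v)"
    by (simp add: free_action_altdef linear_op_scale[OF linear_op_word_op] linear_extension_fun_scale)
qed

lemmas free_action_add = linear_op_add[OF linear_op_free_action]
  and free_action_0 [simp] = linear_op_0[OF linear_op_free_action]

lemma free_action_mult: "free_action D (f * g) v = free_action D f (free_action D g v)"
proof (induction f rule: poly_mapping_additive_induct)
  case (single x d)
  show ?case
  proof (induction g rule: poly_mapping_additive_induct)
    case (single y e)
    show ?case
      by (simp add: mult_single plus_list_def linear_op_scale[OF linear_op_word_op])
  next
    case (add f g)
    then show ?case
      by (simp add: distrib_left free_action_add_left linear_op_add[OF linear_op_word_op] scale_add_right)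
  qed
qed (simp add: distrib_right free_action_add_left)

lemma free_action_one: "free_action D 1 v = v"
  by (metis free_action_single scale_simps(3) single_one word_op_simps(1) zero_list_def)

lemma free_action_letter: "free_action D (letter i) v = letter_op D i v"
  by (simp add: letter_def)

text \<open>Compatibility is asked for single letters on basis elements; it extends along words and
  then linearly. The first part, with \<open>F\<close> the identity, gives the stability of the span
  of tableaux. For \<open>F\<close> gluing with one tensor factor fixed, \<open>k\<close> is 0 or
  \<open>m\<close> according to the factor on which the algebra acts.\<close>

lemma free_action_intertwine:
  assumes F: "linear_op F"
    and closed: "\<And>T i. T \<in> S \<Longrightarrow> i \<in> {1..<N} \<Longrightarrow> Poly_Mapping.keys (pi_tableau D i T) \<subseteq> S"
    and letters: "\<And>T i. T \<in> S \<Longrightarrow> i \<in> {1..<N} \<Longrightarrow>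
      F (pi_tableau D i T) = letter_op D' (i + k) (F (Poly_Mapping.single T 1))"
    and v: "Poly_Mapping.keys v \<subseteq> S" and f: "f \<in> carrier (free_alg N)"
  shows "Poly_Mapping.keys (free_action D f v) \<subseteq> S"
    and "F (free_action D f v) = free_action D' (shift_letters k f) (F v)"
proof -
  have letter_op: "F (letter_op D i u) = letter_op D' (i + k) (F u)"
    if i: "i \<in> {1..<N}" and u: "Poly_Mapping.keys u \<subseteq> S" for i u
    by (rule linear_op_eqI[OF linear_op_comp[OF F linear_op_linear_extension]
          linear_op_comp[OF linear_op_linear_extension F] u])
       (use letters[OF _ i] in simp)
  have word_op: "Poly_Mapping.keys (word_op D w v) \<subseteq> S \<and>
      F (word_op D w v) = word_op D' (map (\<lambda>i. i + k) w) (F v)" if "set w \<subseteq> {1..<N}" for w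
    using that
  proof (induction w)
    case (Cons i w)
    then have "Poly_Mapping.keys (letter_op D i (word_op D w v)) \<subseteq> S"
      by (intro keys_linear_extension closed) auto
    with Cons show ?case by (simp add: letter_op)
  qed (simp add: v)
  have words: "Poly_Mapping.keys f \<subseteq> {w. set w \<subseteq> {1..<N}}"
    using f by (auto simp: carrier_free_alg words_in_def)
  show "Poly_Mapping.keys (free_action D f v) \<subseteq> S"
    unfolding free_action_altdef using word_op words by (intro keys_linear_extension) blast
  show "F (free_action D f v) = free_action D' (shift_letters k f) (F v)"
    by (rule linear_op_eqI[OF linear_op_comp[OF F linear_op_free_action_left]
          linear_op_comp[OF linear_op_free_action_left linear_op_shift_letters] words])
       (simp add: word_op)
qed

section \<open>Bijective fillings and the relations of the 0-Hecke algebra\<close>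

definition fillings :: "(nat \<times> nat) set \<Rightarrow> nat \<Rightarrow> tableau set" where
  "fillings D N = {T \<in> extensional D. bij_betw T D {1..N}}"

lemma fillings_inj: "T \<in> fillings D N \<Longrightarrow> inj_on T D"
  by (simp add: fillings_def bij_betw_def)

lemma fillings_mem: "T \<in> fillings D N \<Longrightarrow> c \<in> D \<Longrightarrow> T c \<in> {1..N}"
  by (auto simp: fillings_def bij_betw_def)

lemma fillings_surj:
  assumes "T \<in> fillings D N" "k \<in> {1..N}"
  obtains c where "c \<in> D" "T c = k"
proof -
  have "k \<in> T ` D" using assms by (simp add: fillings_def bij_betw_def)
  with that show thesis by blast
qed

lemma entry_row_eq: "T \<in> fillings D N \<Longrightarrow> c \<in> D \<Longrightarrow> entry_row D T (T c) = fst c"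
  by (simp add: entry_row_def the_inv_into_f_f fillings_inj)

text \<open>Swaps always stay among bijective fillings, whereas they need not stay among standard
  tableaux. Checking the relations on fillings therefore involves no order conditions.\<close>

lemma swap_entries_fillings:
  assumes "T \<in> fillings D N" "i \<in> {1..<N}"
  shows "swap_entries D i T \<in> fillings D N"
proof -
  have "bij_betw (transpose i (i + 1)) {1..N} {1..N}"
    using assms(2) by (intro bij_betw_transpose_iff) auto
  then have "bij_betw (transpose i (i + 1) \<circ> T) D {1..N}"
    using assms(1) by (auto simp: fillings_def intro: bij_betw_trans)
  then have "bij_betw (swap_entries D i T) D {1..N}"
    by (rule bij_betw_cong[THEN iffD1, rotated]) (simp add: swap_entries_def)
  then show ?thesis by (simp add: fillings_def swap_entries_def)
qed

text \<open>As \<open>pi_tableau\<close> compares only rows of entries, this turns each relation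
  into a comparison of the rows of at most four entries.\<close>

lemma entry_row_swap_entries:
  assumes "T \<in> fillings D N" "i \<in> {1..<N}" "k \<in> {1..N}"
  shows "entry_row D (swap_entries D i T) k = entry_row D T (transpose i (i + 1) k)"
proof -
  have "transpose i (i + 1) k \<in> {1..N}"
    using assms(2,3) by (auto simp: transpose_def)
  then obtain c where c: "c \<in> D" "T c = transpose i (i + 1) k"
    by (rule fillings_surj[OF assms(1)])
  then have "swap_entries D i T c = k" by (simp add: swap_entries_def)
  then have "entry_row D (swap_entries D i T) k = fst c"
    using entry_row_eq[OF swap_entries_fillings[OF assms(1,2)] c(1)] by simp
  then show ?thesis using entry_row_eq[OF assms(1) c(1)] c(2) by simp
qed

lemma swap_entries_braid:
  "swap_entries D i (swap_entries D (Suc i) (swap_entries D i T)) =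
   swap_entries D (Suc i) (swap_entries D i (swap_entries D (Suc i) T))"
  by (rule ext) (auto simp: swap_entries_def transpose_def restrict_def)

lemma swap_entries_commute:
  assumes "\<bar>int i - int j\<bar> \<ge> 2"
  shows "swap_entries D i (swap_entries D j T) = swap_entries D j (swap_entries D i T)"
  using assms by (intro ext) (auto simp: swap_entries_def transpose_def restrict_def)

text \<open>A nonzero result has \<open>i\<close> in a lower row than \<open>i + 1\<close>, and such
  a filling is fixed.\<close>

lemma letter_op_idem:
  assumes T: "T \<in> fillings D N" and i: "i \<in> {1..<N}"
  shows "letter_op D i (pi_tableau D i T) = pi_tableau D i T"
proof -
  have "entry_row D (swap_entries D i T) i = entry_row D T (i + 1)"
    "entry_row D (swap_entries D i T) (i + 1) = entry_row D T i"
    using i by (simp_all add: entry_row_swap_entries[OF T i])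
  then show ?thesis by (auto simp: pi_tableau_def)
qed

lemma letter_op_braid:
  assumes T: "T \<in> fillings D N" and i: "i \<in> {1..<N}" "Suc i \<in> {1..<N}"
  shows "letter_op D i (letter_op D (Suc i) (pi_tableau D i T)) =
    letter_op D (Suc i) (letter_op D i (pi_tableau D (Suc i) T))"
proof -
  let ?j = "Suc i" and ?k = "Suc (Suc i)"
  note swap = swap_entries_fillings[of _ D N]
  have rows: "entry_row D (swap_entries D i U) i = entry_row D U ?j"
    "entry_row D (swap_entries D i U) ?j = entry_row D U i"
    "entry_row D (swap_entries D i U) ?k = entry_row D U ?k"
    "entry_row D (swap_entries D ?j U) i = entry_row D U i"
    "entry_row D (swap_entries D ?j U) ?j = entry_row D U ?k"
    "entry_row D (swap_entries D ?j U) ?k = entry_row D U ?j" if "U \<in> fillings D N" for U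
    using i by (simp_all add: entry_row_swap_entries[OF that])
  have mem: "swap_entries D i U \<in> fillings D N" "swap_entries D ?j U \<in> fillings D N"
    if "U \<in> fillings D N" for U
    using that i by (simp_all add: swap)
  \<comment> \<open>Both sides sort the rows of the three entries. For distinct rows, a sorting that
    takes fewer than three swaps has only one reduced word, so both sides make the same swaps;
    strictly decreasing rows take three swaps in different orders, which agree by
    \<open>swap_entries_braid\<close>. Two equal rows meet in some comparison on either side and
    give 0.\<close>
  show ?thesis
    by (cases "entry_row D T i" "entry_row D T ?j" rule: linorder_cases;
        cases "entry_row D T ?j" "entry_row D T ?k" rule: linorder_cases;
        cases "entry_row D T i" "entry_row D T ?k" rule: linorder_cases)
       (simp_all add: pi_tableau_def rows mem T swap_entries_braid)
qed

text \<open>The pairs \<open>i, i + 1\<close> and \<open>j, j + 1\<close> are disjoint, so neither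
  swap affects the rows that the other operator compares.\<close>

lemma letter_op_commute:
  assumes T: "T \<in> fillings D N" and ij: "i \<in> {1..<N}" "j \<in> {1..<N}" "\<bar>int i - int j\<bar> \<ge> 2"
  shows "letter_op D i (pi_tableau D j T) = letter_op D j (pi_tableau D i T)"
proof -
  have "entry_row D (swap_entries D i T) j = entry_row D T j"
    "entry_row D (swap_entries D i T) (j + 1) = entry_row D T (j + 1)"
    "entry_row D (swap_entries D j T) i = entry_row D T i"
    "entry_row D (swap_entries D j T) (i + 1) = entry_row D T (i + 1)"
    using ij by (simp_all add: entry_row_swap_entries[OF T] transpose_def) linarith+
  then show ?thesis
    using swap_entries_commute[OF ij(3)] by (auto simp: pi_tableau_def)
qed

section \<open>Standard immaculate tableaux as a basis of a module over the quotient algebra\<close>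

lemma SIT_fillings: "SIT \<alpha> \<beta> \<subseteq> fillings (skew_diagram \<alpha> \<beta>) (sum_list \<alpha> - sum_list \<beta>)"
  by (auto simp: SIT_def fillings_def)

text \<open>Every inequality required of a tableau has its smaller entry in the row of the larger
  one or in a lower row. A swap can only disturb an inequality between the cells of \<open>i\<close>
  and \<open>i + 1\<close>, and there the smaller entry sits strictly higher, so none is
  required.\<close>

lemma SIT_swap_entries:
  assumes T: "T \<in> SIT \<alpha> \<beta>" and i: "i \<in> {1..<sum_list \<alpha> - sum_list \<beta>}"
    and rows: "entry_row (skew_diagram \<alpha> \<beta>) T (i + 1) < entry_row (skew_diagram \<alpha> \<beta>) T i"
  shows "swap_entries (skew_diagram \<alpha> \<beta>) i T \<in> SIT \<alpha> \<beta>"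
proof -
  let ?D = "skew_diagram \<alpha> \<beta>"
  have fill: "T \<in> fillings ?D (sum_list \<alpha> - sum_list \<beta>)" using T SIT_fillings by blast
  have mono: "swap_entries ?D i T c < swap_entries ?D i T d"
    if "c \<in> ?D" "d \<in> ?D" "T c < T d" "fst c \<le> fst d" for c d
  proof -
    have "\<not> (T c = i \<and> T d = i + 1)"
      using rows that entry_row_eq[OF fill that(1)] entry_row_eq[OF fill that(2)] by auto
    then show ?thesis
      using that by (auto simp: swap_entries_def transpose_def)
  qed
  show ?thesis
    using T swap_entries_fillings[OF fill i] unfolding SIT_def fillings_def
    by (auto intro!: mono)
qed

lemma keys_pi_tableau:
  assumes "T \<in> SIT \<alpha> \<beta>" "i \<in> {1..<sum_list \<alpha> - sum_list \<beta>}"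
  shows "Poly_Mapping.keys (pi_tableau (skew_diagram \<alpha> \<beta>) i T) \<subseteq> SIT \<alpha> \<beta>"
  using assms SIT_swap_entries by (auto simp: pi_tableau_def)

lemma keys_free_action:
  assumes "Poly_Mapping.keys v \<subseteq> SIT \<alpha> \<beta>" "f \<in> carrier (free_alg (sum_list \<alpha> - sum_list \<beta>))"
  shows "Poly_Mapping.keys (free_action (skew_diagram \<alpha> \<beta>) f v) \<subseteq> SIT \<alpha> \<beta>"
  by (rule free_action_intertwine(1)[OF linear_op_id keys_pi_tableau _ assms,
        where k = 0 and D' = "skew_diagram \<alpha> \<beta>"]) simp_all

text \<open>The elements that annihilate the module form an ideal, so it suffices that the
  generating relations act by zero.\<close>

lemma free_action_ideal:
  assumes "h \<in> hecke_ideal (sum_list \<alpha> - sum_list \<beta>)" "Poly_Mapping.keys v \<subseteq> SIT \<alpha> \<beta>"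
  shows "free_action (skew_diagram \<alpha> \<beta>) h v = 0"
proof -
  let ?N = "sum_list \<alpha> - sum_list \<beta>" and ?D = "skew_diagram \<alpha> \<beta>"
  \<comment> \<open>All vectors are quantified here, not just the given one: in a product
    \<open>f * g\<close> with \<open>f\<close> in \<open>K\<close>, the factor \<open>f\<close>
    meets a vector already moved by \<open>g\<close>.\<close>
  define K where "K = {f \<in> carrier (free_alg ?N).
    \<forall>v. Poly_Mapping.keys v \<subseteq> SIT \<alpha> \<beta> \<longrightarrow> free_action ?D f v = 0}"
  have "ideal K (free_alg ?N)"
  proof (rule idealI[OF ring_free_alg])
    interpret ring "free_alg ?N" by (rule ring_free_alg)
    show "subgroup K (add_monoid (free_alg ?N))"
    proof (rule add.subgroupI)
      show "K \<noteq> {}" using zero_closed by (auto simp: K_def)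
    next
      fix f assume "f \<in> K"
      then show "\<ominus>\<^bsub>free_alg ?N\<^esub> f \<in> K"
        using free_action_diff_left[of ?D 0 f] by (auto simp: K_def free_alg_a_minus free_alg_closed)
    qed (auto simp: K_def free_alg_closed free_action_add_left)
  qed (auto simp: K_def free_alg_closed free_action_mult keys_free_action)
  moreover have "hecke_relations ?N \<subseteq> K"
  proof
    fix h assume h: "h \<in> hecke_relations ?N"
    have "free_action ?D h v = 0" if v: "Poly_Mapping.keys v \<subseteq> SIT \<alpha> \<beta>" for v
    proof -
      have fill: "Poly_Mapping.keys v \<subseteq> fillings ?D ?N" using v SIT_fillings by blast
      have "linear_op (\<lambda>v. 0 :: tableau \<Rightarrow>\<^sub>0 complex)" by (simp add: linear_op_def)
      then show ?thesis
      proof (rule linear_op_eqI[OF linear_op_free_action _ fill])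
        fix T assume T: "T \<in> fillings ?D ?N"
        from h show "free_action ?D h (Poly_Mapping.single T 1) = 0"
        proof (cases rule: hecke_relations_cases)
          case (idem i)
          then show ?thesis
            using letter_op_idem[OF T]
            by (simp add: free_action_diff_left free_action_mult free_action_letter)
        next
          case (braid i)
          then show ?thesis
            using letter_op_braid[OF T, of i]
            by (simp add: free_action_diff_left free_action_mult free_action_letter)
        next
          case (comm i j)
          then show ?thesis
            using letter_op_commute[OF T, of i j]
            by (simp add: free_action_diff_left free_action_mult free_action_letter)
        qed
      qed
    qed
    then show "h \<in> K" using h hecke_relations_closed by (auto simp: K_def)
  qed
  ultimately have "hecke_ideal ?N \<subseteq> K"
    unfolding hecke_ideal_def by (rule ring.genideal_minimal[OF ring_free_alg])
  with assms show ?thesis by (auto simp: K_def)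
qed

lemma tableau_module_simps [simp]:
  "carrier (tableau_module \<alpha> \<beta>) = {v. Poly_Mapping.keys v \<subseteq> SIT \<alpha> \<beta>}"
  "\<zero>\<^bsub>tableau_module \<alpha> \<beta>\<^esub> = 0" "v \<oplus>\<^bsub>tableau_module \<alpha> \<beta>\<^esub> w = v + w"
  by (simp_all add: tableau_module_def)

lemma tableau_module_smult:
  assumes "f \<in> carrier (free_alg (sum_list \<alpha> - sum_list \<beta>))" "Poly_Mapping.keys v \<subseteq> SIT \<alpha> \<beta>"
  shows "hecke_class (sum_list \<alpha> - sum_list \<beta>) f \<odot>\<^bsub>tableau_module \<alpha> \<beta>\<^esub> v =
    free_action (skew_diagram \<alpha> \<beta>) f v"
  using the_elem_image_hecke_class[OF assms(1), of "\<lambda>f. free_action (skew_diagram \<alpha> \<beta>) f v"]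
    free_action_ideal[OF _ assms(2)]
  by (simp add: tableau_module_def free_action_add_left)

lemma left_module_tableau_module: "left_module (hecke (sum_list \<alpha> - sum_list \<beta>)) (tableau_module \<alpha> \<beta>)"
proof -
  let ?N = "sum_list \<alpha> - sum_list \<beta>"
  have add: "Poly_Mapping.keys (v + w) \<subseteq> SIT \<alpha> \<beta>"
    if "Poly_Mapping.keys v \<subseteq> SIT \<alpha> \<beta>" "Poly_Mapping.keys w \<subseteq> SIT \<alpha> \<beta>"
    for v w :: "tableau \<Rightarrow>\<^sub>0 complex"
    using that Poly_Mapping.keys_add[of v w] by blast
  have "abelian_group (tableau_module \<alpha> \<beta>)"
  proof (rule abelian_groupI)
    fix v assume "v \<in> carrier (tableau_module \<alpha> \<beta>)"
    then show "\<exists>w\<in>carrier (tableau_module \<alpha> \<beta>). w \<oplus>\<^bsub>tableau_module \<alpha> \<beta>\<^esub> v = \<zero>\<^bsub>tableau_module \<alpha> \<beta>\<^esub>"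
      by (intro bexI[of _ "- v"]) (auto simp: in_keys_iff)
  qed (simp_all add: add add_ac)
  moreover have "left_module_axioms (hecke ?N) (tableau_module \<alpha> \<beta>)"
    by (rule left_module_axioms.intro)
       (auto simp: carrier_hecke tableau_module_smult add keys_free_action free_action_add
          free_alg_closed free_action_add_left free_action_mult free_action_one
          simp flip: hecke_class_add hecke_class_mult hecke_class_one
          dest: subsetD[OF keys_free_action])
  ultimately show ?thesis
    using ring_hecke by (simp add: left_module_def)
qed


section \<open>Cutting tableaux\<close>

lemma diagram_Sigma: "diagram \<beta> = (SIGMA i:{..<length \<beta>}. {..<\<beta> ! i})"
  by (auto simp: diagram_def)

lemma finite_diagram: "finite (diagram \<beta>)"
  by (simp add: diagram_Sigma)

lemma card_diagram: "card (diagram \<beta>) = sum_list \<beta>"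
  by (simp add: diagram_Sigma sum_list_sum_nth atLeast0LessThan)

lemma diagram_Nil [simp]: "diagram [] = {}"
  by (simp add: diagram_def)

lemma skew_diagram_Nil [simp]: "skew_diagram \<alpha> [] = diagram \<alpha>"
  by (simp add: skew_diagram_def)

lemma diagram_mono: "comp_contained \<beta> \<alpha> \<Longrightarrow> diagram \<beta> \<subseteq> diagram \<alpha>"
  by (fastforce simp: comp_contained_def diagram_def)

lemma card_skew_diagram:
  "comp_contained \<beta> \<alpha> \<Longrightarrow> card (skew_diagram \<alpha> \<beta>) = sum_list \<alpha> - sum_list \<beta>"
  by (simp add: skew_diagram_def card_Diff_subset diagram_mono finite_diagram card_diagram)

lemma sum_list_contained: "comp_contained \<beta> \<alpha> \<Longrightarrow> sum_list \<beta> \<le> sum_list \<alpha>"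
  using card_mono[OF finite_diagram diagram_mono] by (simp add: card_diagram)

text \<open>Positive parts make the first column show the number of rows; a trailing zero part would
  leave no cell.\<close>

lemma diagram_inject:
  assumes "is_composition \<beta> k" "is_composition \<gamma> l" "diagram \<beta> = diagram \<gamma>"
  shows "\<beta> = \<gamma>"
proof -
  have len: "{i. (i, 0) \<in> diagram \<beta>} = {..<length \<beta>}" if "is_composition \<beta> k" for \<beta> k
    using that by (auto simp: diagram_def is_composition_def)
  have row: "{j. (i, j) \<in> diagram \<beta>} = {..<\<beta> ! i}" if "i < length \<beta>" for \<beta> i
    using that by (auto simp: diagram_def)
  have "length \<beta> = length \<gamma>"
    using len[OF assms(1)] len[OF assms(2)] assms(3) by (metis card_lessThan)
  then show ?thesis
    using row[of _ \<beta>] row[of _ \<gamma>] assms(3) by (intro nth_equalityI) (auto simp: lessThan_eq_iff)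
qed

lemma downward_closed_eq_lessThan:
  fixes A :: "nat set"
  assumes "finite A" "\<And>x y. x \<in> A \<Longrightarrow> y < x \<Longrightarrow> y \<in> A"
  shows "A = {..<card A}"
proof (cases "A = {}")
  case False
  have "A = {..Max A}"
    using assms Max_ge[OF assms(1)] Max_in[OF assms(1) False] by (auto simp: le_less)
  then show ?thesis by (metis card_atMost lessThan_Suc_atMost)
qed simp

lemma finite_contained_compositions: "finite {\<beta>. is_composition \<beta> m \<and> comp_contained \<beta> \<alpha>}"
proof (rule finite_subset)
  show "{\<beta>. is_composition \<beta> m \<and> comp_contained \<beta> \<alpha>} \<subseteq>
      {\<beta>. set \<beta> \<subseteq> {..m} \<and> length \<beta> \<le> length \<alpha>}"
    using member_le_sum_list by (auto simp: is_composition_def comp_contained_def)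
qed (rule finite_lists_length_le, simp)

lemma SIT_small_entries:
  assumes \<alpha>: "is_composition \<alpha> n" and S: "S \<in> SIT \<alpha> []" and m: "m \<le> n"
  obtains \<beta> where "is_composition \<beta> m" "comp_contained \<beta> \<alpha>"
    "diagram \<beta> = {c \<in> diagram \<alpha>. S c \<le> m}"
proof -
  define row where "row i = {j. j < \<alpha> ! i \<and> S (i, j) \<le> m}" for i
  define R where "R = {i. i < length \<alpha> \<and> S (i, 0) \<le> m}"
  \<comment> \<open>Counting describes the cut: \<open>R\<close> and each \<open>row i\<close> with
    \<open>i < length \<alpha>\<close> turn out to be initial segments, hence are determined by
    their cardinalities.\<close>
  define \<beta> where "\<beta> = map (\<lambda>i. card (row i)) [0..<card R]"
  have pos: "0 < \<alpha> ! i" if "i < length \<alpha>" for i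
    using \<alpha> that by (simp add: is_composition_def)
  have col: "S (i, 0) < S (i', 0)" if "i < i'" "i' < length \<alpha>" for i i'
    using S that pos by (auto simp: SIT_def diagram_def)
  have row_mono: "S (i, j) < S (i, j')" if "i < length \<alpha>" "j < j'" "j' < \<alpha> ! i" for i j j'
    using S that by (auto simp: SIT_def diagram_def)
  have R: "R = {..<card R}"
  proof (rule downward_closed_eq_lessThan)
    fix x y assume "x \<in> R" "y < x"
    then show "y \<in> R" using col[of y x] by (auto simp: R_def)
  qed (simp add: R_def)
  have R_iff: "i < card R \<longleftrightarrow> i < length \<alpha> \<and> S (i, 0) \<le> m" for i
    using R by (auto simp: R_def)
  have row: "row i = {..<card (row i)}" if "i < length \<alpha>" for i
  proof (rule downward_closed_eq_lessThan)
    fix x y assume "x \<in> row i" "y < x"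
    then show "y \<in> row i" using row_mono[OF that, of y x] by (auto simp: row_def)
  qed (simp add: row_def)
  have row_iff: "j < card (row i) \<longleftrightarrow> j < \<alpha> ! i \<and> S (i, j) \<le> m" if "i < length \<alpha>" for i j
    using row[OF that] by (auto simp: row_def)
  \<comment> \<open>A small entry forces a small first entry in its row, so the rows outside
    \<open>R\<close> contain no small entry.\<close>
  have "S (i, 0) \<le> m" if "i < length \<alpha>" "j < \<alpha> ! i" "S (i, j) \<le> m" for i j
    using row_mono[of i 0 j] that by (cases "j = 0") auto
  then have diag: "diagram \<beta> = {c \<in> diagram \<alpha>. S c \<le> m}"
    by (auto simp: diagram_def \<beta>_def R_iff row_iff)
  have "comp_contained \<beta> \<alpha>"
    unfolding comp_contained_def
  proof (intro conjI allI impI)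
    show "length \<beta> \<le> length \<alpha>"
      using card_mono[of "{..<length \<alpha>}" R] by (auto simp: \<beta>_def R_def)
    fix i assume "i < length \<beta>"
    then have i: "i < card R" by (simp add: \<beta>_def)
    \<comment> \<open>The cell \<open>(i, \<alpha> ! i)\<close> is the first one beyond row
      \<open>i\<close> of \<alpha>, which bounds the count.\<close>
    then have "\<not> \<alpha> ! i < card (row i)" using row_iff[of i "\<alpha> ! i"] R_iff by auto
    with i show "\<beta> ! i \<le> \<alpha> ! i" by (simp add: \<beta>_def)
  qed
  moreover have "is_composition \<beta> m"
    unfolding is_composition_def
  proof
    show "\<forall>b\<in>set \<beta>. 0 < b"
      using pos by (auto simp: \<beta>_def R_iff row_iff)
    \<comment> \<open>The size of \<beta> is counted by entries: \<open>S\<close> is a bijection and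
      \<open>m \<le> n\<close>, so each of the values 1 to \<open>m\<close> occurs in exactly one
      cell.\<close>
    have bij: "bij_betw S (diagram \<alpha>) {1..n}"
      using S \<alpha> by (simp add: SIT_def is_composition_def)
    have "S ` {c \<in> diagram \<alpha>. S c \<le> m} = {1..m}"
    proof -
      have "S ` {c \<in> diagram \<alpha>. S c \<le> m} = {k \<in> S ` diagram \<alpha>. k \<le> m}" by auto
      then show ?thesis using bij m by (auto simp: bij_betw_def)
    qed
    moreover have "inj_on S {c \<in> diagram \<alpha>. S c \<le> m}"
      using bij by (rule inj_on_subset[OF bij_betw_imp_inj_on]) auto
    ultimately have "card {c \<in> diagram \<alpha>. S c \<le> m} = m"
      using card_image by fastforce
    then show "sum_list \<beta> = m" using card_diagram[of \<beta>] diag by simp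
  qed
  ultimately show thesis using that diag by blast
qed

section \<open>Gluing a straight and a skew tableau\<close>

definition glue :: "nat list \<Rightarrow> nat list \<Rightarrow> nat \<Rightarrow> tableau \<Rightarrow> tableau \<Rightarrow> tableau" where
  "glue \<alpha> \<beta> m T U = (\<lambda>c\<in>diagram \<alpha>. if c \<in> diagram \<beta> then T c else U c + m)"

locale contained_composition =
  fixes \<alpha> \<beta> :: "nat list" and n m :: nat
  assumes comp_\<alpha>: "is_composition \<alpha> n" and comp_\<beta>: "is_composition \<beta> m"
    and contained: "comp_contained \<beta> \<alpha>"
begin

lemma sums [simp]: "sum_list \<alpha> = n" "sum_list \<beta> = m"
  using comp_\<alpha> comp_\<beta> by (simp_all add: is_composition_def)

lemma m_le_n: "m \<le> n"
  using sum_list_contained[OF contained] by simp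

lemma sub: "diagram \<beta> \<subseteq> diagram \<alpha>"
  by (rule diagram_mono[OF contained])

lemma skew_iff: "c \<in> skew_diagram \<alpha> \<beta> \<longleftrightarrow> c \<in> diagram \<alpha> \<and> c \<notin> diagram \<beta>"
  by (simp add: skew_diagram_def)

abbreviation G where "G \<equiv> glue \<alpha> \<beta> m"

lemma fillings_straight: "T \<in> SIT \<beta> [] \<Longrightarrow> T \<in> fillings (diagram \<beta>) m"
  using SIT_fillings[of \<beta> "[]"] by auto

lemma fillings_skew: "U \<in> SIT \<alpha> \<beta> \<Longrightarrow> U \<in> fillings (skew_diagram \<alpha> \<beta>) (n - m)"
  using SIT_fillings[of \<alpha> \<beta>] by auto

lemma glue_straight: "c \<in> diagram \<beta> \<Longrightarrow> G T U c = T c"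
  using sub by (auto simp: glue_def)

lemma glue_skew: "c \<in> skew_diagram \<alpha> \<beta> \<Longrightarrow> G T U c = U c + m"
  by (auto simp: glue_def skew_iff)

lemma straight_le: "T \<in> SIT \<beta> [] \<Longrightarrow> c \<in> diagram \<beta> \<Longrightarrow> 1 \<le> T c \<and> T c \<le> m"
  using fillings_mem[OF fillings_straight] by fastforce

lemma skew_le: "U \<in> SIT \<alpha> \<beta> \<Longrightarrow> c \<in> skew_diagram \<alpha> \<beta> \<Longrightarrow> 1 \<le> U c \<and> U c + m \<le> n"
  using fillings_mem[OF fillings_skew] m_le_n by fastforce

text \<open>This recovers the diagram of \<beta> from the glued tableau, so different \<beta> give
  disjoint sets of glued tableaux.\<close>

lemma glue_le_iff:
  "T \<in> SIT \<beta> [] \<Longrightarrow> U \<in> SIT \<alpha> \<beta> \<Longrightarrow> c \<in> diagram \<alpha> \<Longrightarrow> G T U c \<le> m \<longleftrightarrow> c \<in> diagram \<beta>"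
  using straight_le skew_le[of U c] by (auto simp: glue_def skew_iff)

lemma glue_SIT:
  assumes T: "T \<in> SIT \<beta> []" and U: "U \<in> SIT \<alpha> \<beta>"
  shows "G T U \<in> SIT \<alpha> []"
proof -
  have T_bij: "bij_betw T (diagram \<beta>) {1..m}" and U_bij: "bij_betw U (skew_diagram \<alpha> \<beta>) {1..n - m}"
    using fillings_straight[OF T] fillings_skew[OF U] by (simp_all add: fillings_def)
  have "bij_betw (\<lambda>k. k + m) {1..n - m} {m + 1..n}"
    using m_le_n by (intro bij_betw_byWitness[where f' = "\<lambda>k. k - m"]) auto
  from bij_betw_trans[OF U_bij this]
  have "bij_betw (\<lambda>c. U c + m) (skew_diagram \<alpha> \<beta>) {m + 1..n}" by (simp add: o_def)
  then have "bij_betw (G T U) (skew_diagram \<alpha> \<beta>) {m + 1..n}"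
    using glue_skew by (subst bij_betw_cong) auto
  moreover have "bij_betw (G T U) (diagram \<beta>) {1..m}"
    using T_bij glue_straight by (subst bij_betw_cong) auto
  ultimately have "bij_betw (G T U) (diagram \<beta> \<union> skew_diagram \<alpha> \<beta>) ({1..m} \<union> {m + 1..n})"
    by (intro bij_betw_combine) auto
  moreover have "diagram \<beta> \<union> skew_diagram \<alpha> \<beta> = diagram \<alpha>" "{1..m} \<union> {m + 1..n} = {1..n}"
    using sub m_le_n by (auto simp: skew_iff)
  ultimately have bij: "bij_betw (G T U) (diagram \<alpha>) {1..n}" by simp
  \<comment> \<open>If just one of the two cells lies in \<beta>, its entry is at most
    \<open>m\<close> and the other one exceeds \<open>m\<close>. The condition \<open>closed\<close>
    rules out that this comparison goes the wrong way.\<close>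
  have mono: "G T U c < G T U d"
    if c: "c \<in> diagram \<alpha>" and d: "d \<in> diagram \<alpha>"
      and closed: "d \<in> diagram \<beta> \<Longrightarrow> c \<in> diagram \<beta>"
      and "c \<in> diagram \<beta> \<Longrightarrow> d \<in> diagram \<beta> \<Longrightarrow> T c < T d"
      and "c \<in> skew_diagram \<alpha> \<beta> \<Longrightarrow> d \<in> skew_diagram \<alpha> \<beta> \<Longrightarrow> U c < U d" for c d
    using that straight_le[OF T, of c] skew_le[OF U, of d] by (auto simp: glue_def skew_iff)
  have T_col: "T (i, 0) < T (i', 0)" if "(i, 0) \<in> diagram \<beta>" "(i', 0) \<in> diagram \<beta>" "i < i'" for i i'
    using T that by (auto simp: SIT_def)
  have T_row: "T (i, j) < T (i, j')" if "(i, j) \<in> diagram \<beta>" "(i, j') \<in> diagram \<beta>" "j < j'" for i j j'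
    using T that by (auto simp: SIT_def)
  have U_col: "U (i, 0) < U (i', 0)"
    if "(i, 0) \<in> skew_diagram \<alpha> \<beta>" "(i', 0) \<in> skew_diagram \<alpha> \<beta>" "i < i'" for i i'
    using U that by (auto simp: SIT_def)
  have U_row: "U (i, j) < U (i, j')"
    if "(i, j) \<in> skew_diagram \<alpha> \<beta>" "(i, j') \<in> skew_diagram \<alpha> \<beta>" "j < j'" for i j j'
    using U that by (auto simp: SIT_def)
  \<comment> \<open>A row below an occupied row of \<beta> is nonempty because the parts of a
    composition are positive; this supplies \<open>closed\<close> in the first column.\<close>
  have "(i, 0) \<in> diagram \<beta>" if "(i', 0) \<in> diagram \<beta>" "i < i'" for i i'
    using that comp_\<beta> by (auto simp: diagram_def is_composition_def)
  moreover have "(i, j) \<in> diagram \<beta>" if "(i, j') \<in> diagram \<beta>" "j < j'" for i j j'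
    using that by (auto simp: diagram_def)
  moreover have "G T U \<in> extensional (diagram \<alpha>)" by (simp add: glue_def)
  ultimately show ?thesis
    unfolding SIT_def using bij
    by (auto intro!: mono intro: T_col T_row U_col U_row)
qed

lemma glue_inject:
  assumes "T \<in> SIT \<beta> []" "U \<in> SIT \<alpha> \<beta>" "T' \<in> SIT \<beta> []" "U' \<in> SIT \<alpha> \<beta>" "G T U = G T' U'"
  shows "T = T'" "U = U'"
proof -
  show "T = T'"
  proof (rule extensionalityI[of _ "diagram \<beta>"])
    fix c assume "c \<in> diagram \<beta>"
    then show "T c = T' c" using assms(5) glue_straight by metis
  qed (use assms in \<open>auto simp: SIT_def\<close>)
  show "U = U'"
  proof (rule extensionalityI[of _ "skew_diagram \<alpha> \<beta>"])
    fix c assume "c \<in> skew_diagram \<alpha> \<beta>"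
    then show "U c = U' c" using assms(5) glue_skew by (metis add_right_cancel)
  qed (use assms in \<open>auto simp: SIT_def\<close>)
qed

lemma glue_surj:
  assumes S: "S \<in> SIT \<alpha> []" and diag: "diagram \<beta> = {c \<in> diagram \<alpha>. S c \<le> m}"
  obtains T U where "T \<in> SIT \<beta> []" "U \<in> SIT \<alpha> \<beta>" "S = G T U"
proof -
  define T where "T = restrict S (diagram \<beta>)"
  define U where "U = (\<lambda>c\<in>skew_diagram \<alpha> \<beta>. S c - m)"
  have bij: "bij_betw S (diagram \<alpha>) {1..n}" using S by (simp add: SIT_def)
  have "S ` diagram \<beta> = {k \<in> S ` diagram \<alpha>. k \<le> m}"
    "S ` skew_diagram \<alpha> \<beta> = {k \<in> S ` diagram \<alpha>. m < k}"
    using diag by (auto simp: skew_iff)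
  then have "S ` diagram \<beta> = {1..m}" "S ` skew_diagram \<alpha> \<beta> = {m + 1..n}"
    using bij m_le_n by (auto simp: bij_betw_def)
  then have S_bij: "bij_betw S (diagram \<beta>) {1..m}" "bij_betw S (skew_diagram \<alpha> \<beta>) {m + 1..n}"
    by (auto intro!: bij_betw_subset[OF bij] simp: skew_iff subsetD[OF sub])
  have "bij_betw (\<lambda>k. k - m) {m + 1..n} {1..n - m}"
    using m_le_n by (intro bij_betw_byWitness[where f' = "\<lambda>k. k + m"]) auto
  from bij_betw_trans[OF S_bij(2) this]
  have "bij_betw (\<lambda>c. S c - m) (skew_diagram \<alpha> \<beta>) {1..n - m}" by (simp add: o_def)
  then have U_bij: "bij_betw U (skew_diagram \<alpha> \<beta>) {1..n - m}"
    unfolding U_def by (subst bij_betw_restrict_eq)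
  have T_bij: "bij_betw T (diagram \<beta>) {1..m}"
    unfolding T_def using S_bij(1) by (subst bij_betw_restrict_eq)
  have large: "m < S c" if "c \<in> skew_diagram \<alpha> \<beta>" for c
    using that unfolding skew_iff diag by (simp add: not_le)
  have col: "S (i, 0) < S (i', 0)" if "(i, 0) \<in> diagram \<alpha>" "(i', 0) \<in> diagram \<alpha>" "i < i'" for i i'
    using S that unfolding SIT_def skew_diagram_Nil by blast
  have row: "S (i, j) < S (i, j')" if "(i, j) \<in> diagram \<alpha>" "(i, j') \<in> diagram \<alpha>" "j < j'" for i j j'
    using S that unfolding SIT_def skew_diagram_Nil by blast
  show thesis
  proof
    show "T \<in> SIT \<beta> []"
      using T_bij sub by (auto simp: SIT_def T_def intro!: col row)
    show "U \<in> SIT \<alpha> \<beta>"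
    proof -
      \<comment> \<open>Truncated subtraction of \<open>m\<close> preserves strict inequalities
        because the entries on the skew part exceed \<open>m\<close>.\<close>
      have shift: "S c - m < S d - m" if "c \<in> skew_diagram \<alpha> \<beta>" "S c < S d" for c d
        using large[OF that(1)] that(2) by linarith
      then show ?thesis
        using U_bij by (auto simp: SIT_def U_def skew_iff intro!: shift col row)
    qed
    show "S = G T U"
    proof (rule extensionalityI[of _ "diagram \<alpha>"])
      fix c assume "c \<in> diagram \<alpha>"
      then show "S c = G T U c"
        using large[of c] by (auto simp: glue_def T_def U_def skew_iff)
    qed (use S in \<open>auto simp: SIT_def glue_def\<close>)
  qed
qed

text \<open>Both entries \<open>i\<close> and \<open>i + 1\<close> are at most \<open>m\<close>, so
  they lie in \<beta>, in the same rows as before gluing, and their swap moves no entry of the skew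
  part.\<close>

lemma pi_tableau_glue_straight:
  assumes T: "T \<in> SIT \<beta> []" and U: "U \<in> SIT \<alpha> \<beta>" and i: "i \<in> {1..<m}"
  shows "pi_tableau (diagram \<alpha>) i (G T U) = relabel (\<lambda>T. G T U) (pi_tableau (diagram \<beta>) i T)"
proof -
  have fill: "G T U \<in> fillings (diagram \<alpha>) n"
    using SIT_fillings[of \<alpha> "[]"] glue_SIT[OF T U] by auto
  have row: "entry_row (diagram \<alpha>) (G T U) k = entry_row (diagram \<beta>) T k" if k: "k \<in> {1..m}" for k
  proof -
    obtain c where c: "c \<in> diagram \<beta>" "T c = k"
      using fillings_surj[OF fillings_straight[OF T] k] .
    then show ?thesis
      using entry_row_eq[OF fill, of c] entry_row_eq[OF fillings_straight[OF T], of c] sub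
        glue_straight[of c T U] by auto
  qed
  have "swap_entries (diagram \<alpha>) i (G T U) = G (swap_entries (diagram \<beta>) i T) U"
  proof
    fix c
    show "swap_entries (diagram \<alpha>) i (G T U) c = G (swap_entries (diagram \<beta>) i T) U c"
      using i skew_le[OF U, of c] sub by (auto simp: swap_entries_def glue_def transpose_def skew_iff)
  qed
  then show ?thesis
    using i by (simp add: pi_tableau_def row linear_op_0[OF linear_op_relabel])
qed

text \<open>The letter is raised by \<open>m\<close> just as gluing raises the skew entries, so both
  entries concerned lie outside \<beta>. This matches the shift of generators in
  \<open>hecke_embed m\<close>.\<close>

lemma pi_tableau_glue_skew:
  assumes T: "T \<in> SIT \<beta> []" and U: "U \<in> SIT \<alpha> \<beta>" and i: "i \<in> {1..<n - m}"
  shows "pi_tableau (diagram \<alpha>) (i + m) (G T U) = relabel (G T) (pi_tableau (skew_diagram \<alpha> \<beta>) i U)"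
proof -
  have fill: "G T U \<in> fillings (diagram \<alpha>) n"
    using SIT_fillings[of \<alpha> "[]"] glue_SIT[OF T U] by auto
  have row: "entry_row (diagram \<alpha>) (G T U) (k + m) = entry_row (skew_diagram \<alpha> \<beta>) U k"
    if k: "k \<in> {1..n - m}" for k
  proof -
    obtain c where c: "c \<in> skew_diagram \<alpha> \<beta>" "U c = k"
      using fillings_surj[OF fillings_skew[OF U] k] .
    then show ?thesis
      using entry_row_eq[OF fill, of c] entry_row_eq[OF fillings_skew[OF U], of c]
        glue_skew[of c T U] by (auto simp: skew_iff)
  qed
  have "swap_entries (diagram \<alpha>) (i + m) (G T U) = G T (swap_entries (skew_diagram \<alpha> \<beta>) i U)"
  proof
    fix c
    show "swap_entries (diagram \<alpha>) (i + m) (G T U) c = G T (swap_entries (skew_diagram \<alpha> \<beta>) i U) c"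
      using i straight_le[OF T, of c] by (auto simp: swap_entries_def glue_def transpose_def skew_iff)
  qed
  then show ?thesis
    using i row[of i] row[of "Suc i"] by (simp add: pi_tableau_def linear_op_0[OF linear_op_relabel])
qed

end

lemma bij_betw_glue:
  assumes \<alpha>: "is_composition \<alpha> n" and m: "m \<le> n"
  shows "bij_betw (\<lambda>(\<beta>, T, U). glue \<alpha> \<beta> m T U)
    (SIGMA \<beta>:{\<beta>. is_composition \<beta> m \<and> comp_contained \<beta> \<alpha>}. SIT \<beta> [] \<times> SIT \<alpha> \<beta>) (SIT \<alpha> [])"
proof -
  have loc: "contained_composition \<alpha> \<beta> n m" if "is_composition \<beta> m" "comp_contained \<beta> \<alpha>" for \<beta>
    using \<alpha> that by unfold_locales
  show ?thesis
    unfolding bij_betw_def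
  proof (intro conjI equalityI subsetI inj_onI; clarsimp)
    fix \<beta> T U \<gamma> T' U'
    assume \<beta>: "is_composition \<beta> m" "comp_contained \<beta> \<alpha>" "T \<in> SIT \<beta> []" "U \<in> SIT \<alpha> \<beta>"
      and \<gamma>: "is_composition \<gamma> m" "comp_contained \<gamma> \<alpha>" "T' \<in> SIT \<gamma> []" "U' \<in> SIT \<alpha> \<gamma>"
      and eq: "glue \<alpha> \<beta> m T U = glue \<alpha> \<gamma> m T' U'"
    interpret \<beta>: contained_composition \<alpha> \<beta> n m using loc \<beta> by blast
    interpret \<gamma>: contained_composition \<alpha> \<gamma> n m using loc \<gamma> by blast
    have "diagram \<beta> = {c \<in> diagram \<alpha>. glue \<alpha> \<beta> m T U c \<le> m}"
      using \<beta>.glue_le_iff[OF \<beta>(3,4)] \<beta>.sub by auto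
    also have "\<dots> = diagram \<gamma>"
      unfolding eq using \<gamma>.glue_le_iff[OF \<gamma>(3,4)] \<gamma>.sub by auto
    finally have "\<beta> = \<gamma>" using diagram_inject \<beta>(1) \<gamma>(1) by blast
    then show "\<beta> = \<gamma> \<and> T = T' \<and> U = U'"
      using \<beta>.glue_inject[of T U T' U'] \<beta> \<gamma> eq by blast
  next
    fix \<beta> T U
    assume "is_composition \<beta> m" "comp_contained \<beta> \<alpha>" "T \<in> SIT \<beta> []" "U \<in> SIT \<alpha> \<beta>"
    then show "glue \<alpha> \<beta> m T U \<in> SIT \<alpha> []"
      using contained_composition.glue_SIT[OF loc] by blast
  next
    fix S assume S: "S \<in> SIT \<alpha> []"
    obtain \<beta> where \<beta>: "is_composition \<beta> m" "comp_contained \<beta> \<alpha>"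
      and diag: "diagram \<beta> = {c \<in> diagram \<alpha>. S c \<le> m}"
      using SIT_small_entries[OF \<alpha> S m] .
    obtain T U where "T \<in> SIT \<beta> []" "U \<in> SIT \<alpha> \<beta>" "S = glue \<alpha> \<beta> m T U"
      using contained_composition.glue_surj[OF loc[OF \<beta>] S diag] .
    with \<beta> show "S \<in> (\<lambda>(\<beta>, T, U). glue \<alpha> \<beta> m T U) `
        (SIGMA \<beta>:{\<beta>. is_composition \<beta> m \<and> comp_contained \<beta> \<alpha>}. SIT \<beta> [] \<times> SIT \<alpha> \<beta>)"
      by force
  qed
qed


section \<open>Parabolic subalgebras\<close>

lemma hecke_subalgebra_generators:
  assumes "J \<subseteq> {1..<n}"
  shows "range (hecke_scalar n) \<union> hecke_gen n ` J \<subseteq> carrier (hecke n)"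
  using assms
  by (auto simp: hecke_scalar_def hecke_gen_def intro!: hecke_class_closed free_alg_closed)

lemma subring_hecke_subalgebra:
  assumes "J \<subseteq> {1..<n}"
  shows "subring (carrier (hecke_subalgebra n J)) (hecke n)"
  using ring.generate_ring_is_subring[OF ring_hecke hecke_subalgebra_generators[OF assms]]
  by (simp add: hecke_subalgebra_def)

lemma hecke_subalgebra_altdef:
  "hecke_subalgebra n J = (hecke n)\<lparr>carrier := carrier (hecke_subalgebra n J)\<rparr>"
  by (simp add: hecke_subalgebra_def)

lemma words_in_free_alg: "J \<subseteq> {1..<n} \<Longrightarrow> f \<in> words_in J \<Longrightarrow> f \<in> carrier (free_alg n)"
  by (fastforce simp: carrier_free_alg words_in_def)

text \<open>The classes of elements of \<open>words_in J\<close> contain the generators and are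
  closed under the ring operations; scalars are the classes of multiples of the empty word.\<close>

lemma hecke_subalgebra_class:
  assumes J: "J \<subseteq> {1..<n}" and x: "x \<in> carrier (hecke_subalgebra n J)"
  obtains f where "f \<in> words_in J" "x = hecke_class n f"
proof -
  have "x \<in> generate_ring (hecke n) (range (hecke_scalar n) \<union> hecke_gen n ` J)"
    using x by (simp add: hecke_subalgebra_def)
  then have "\<exists>f\<in>words_in J. x = hecke_class n f"
  proof induction
    case one
    show ?case using words_in_1 by (intro bexI[of _ 1]) (simp_all add: hecke_class_one)
  next
    case (incl h)
    then consider c where "h = hecke_scalar n c" | i where "i \<in> J" "h = hecke_gen n i" by blast
    then show ?case
    proof cases
      case 1
      then show ?thesis using words_in_single[of "[]" J c] by (auto simp: hecke_scalar_def)
    next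
      case 2
      then show ?thesis using words_in_letter by (auto simp: hecke_gen_def)
    qed
  next
    case (a_inv h)
    then obtain f where "f \<in> words_in J" "h = hecke_class n f" by blast
    then show ?case
      by (intro bexI[of _ "- f"]) (simp_all add: words_in_uminus hecke_class_uminus words_in_free_alg[OF J])
  next
    case (eng_add h1 h2)
    then obtain f g where "f \<in> words_in J" "h1 = hecke_class n f" "g \<in> words_in J" "h2 = hecke_class n g"
      by blast
    then show ?case
      by (intro bexI[of _ "f + g"]) (simp_all add: words_in_add hecke_class_add words_in_free_alg[OF J])
  next
    case (eng_mult h1 h2)
    then obtain f g where "f \<in> words_in J" "h1 = hecke_class n f" "g \<in> words_in J" "h2 = hecke_class n g"
      by blast
    then show ?case
      by (intro bexI[of _ "f * g"]) (simp_all add: words_in_mult hecke_class_mult words_in_free_alg[OF J])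
  qed
  with that show thesis by blast
qed

section \<open>Normal form of words that avoid the letter \<open>m\<close>\<close>

lemma hecke_class_word_append:
  assumes "set u \<subseteq> {1..<n}" "set w \<subseteq> {1..<n}"
  shows "hecke_class n (Poly_Mapping.single (u @ w) (c * d)) =
    hecke_class n (Poly_Mapping.single u c) \<otimes>\<^bsub>hecke n\<^esub> hecke_class n (Poly_Mapping.single w d)"
  using assms by (simp add: free_alg_closed mult_single plus_list_def flip: hecke_class_mult)

lemma hecke_class_word_cong:
  assumes "set u \<subseteq> {1..<n}" "set w \<subseteq> {1..<n}" "set w' \<subseteq> {1..<n}"
    and "hecke_class n (Poly_Mapping.single w c) = hecke_class n (Poly_Mapping.single w' c)"
  shows "hecke_class n (Poly_Mapping.single (u @ w) c) = hecke_class n (Poly_Mapping.single (u @ w') c)"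
  using hecke_class_word_append[OF assms(1,2), of 1 c] hecke_class_word_append[OF assms(1,3), of 1 c]
    assms(4) by simp

lemma hecke_class_commute_letters:
  assumes "i \<in> {1..<n}" "j \<in> {1..<n}" "\<bar>int i - int j\<bar> \<ge> 2" "set w \<subseteq> {1..<n}"
  shows "hecke_class n (Poly_Mapping.single (i # j # w) c) = hecke_class n (Poly_Mapping.single (j # i # w) c)"
proof -
  have "letter i * letter j - letter j * letter i \<in> hecke_relations n"
    unfolding hecke_relations_def using assms(1-3)
    by (intro UnI2 CollectI exI[of _ i] exI[of _ j] conjI refl)
  then have "letter i * letter j - letter j * letter i \<in> hecke_ideal n"
    using hecke_relations_ideal by blast
  then have "hecke_class n (letter i * letter j) = hecke_class n (letter j * letter i)"
    using assms by (intro hecke_class_eqI) (simp_all add: free_alg_closed)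
  then have "hecke_class n (Poly_Mapping.single [i, j] 1) = hecke_class n (Poly_Mapping.single [j, i] 1)"
    by (simp add: letter_def mult_single plus_list_def)
  then show ?thesis
    using hecke_class_word_append[of "[i, j]" n w 1 c] hecke_class_word_append[of "[j, i]" n w 1 c] assms
    by simp
qed

text \<open>The index \<open>m\<close> separates the letters: one above \<open>m\<close> and one
  below it differ by at least 2, so the commutation relation applies at each step.\<close>

lemma hecke_class_move_letter:
  assumes "m < i" "i < n" "set u \<subseteq> {1..<m}" "set z \<subseteq> {1..<n}"
  shows "hecke_class n (Poly_Mapping.single (i # u @ z) c) = hecke_class n (Poly_Mapping.single (u @ i # z) c)"
  using assms(3)
proof (induction u)
  case (Cons j u)
  have "hecke_class n (Poly_Mapping.single (i # (j # u) @ z) c) =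
      hecke_class n (Poly_Mapping.single (j # i # u @ z) c)"
    using assms Cons.prems by (simp, intro hecke_class_commute_letters) auto
  also have "\<dots> = hecke_class n (Poly_Mapping.single ((j # u) @ i # z) c)"
  proof -
    have "i \<in> {1..<n}" "j \<in> {1..<n}" "set u \<subseteq> {1..<n}" using assms Cons.prems by auto
    moreover have "hecke_class n (Poly_Mapping.single (i # u @ z) c) =
        hecke_class n (Poly_Mapping.single (u @ i # z) c)"
      using Cons by simp
    ultimately show ?thesis
      using hecke_class_word_cong[of "[j]" n "i # u @ z" "u @ i # z" c] assms(4) by simp
  qed
  finally show ?case .
qed simp

text \<open>Each block keeps its internal order, so only commutations across \<open>m\<close> are
  used: the head of the word either stays in front or moves past the small letters.\<close>

lemma hecke_class_sort_word:
  assumes "set w \<subseteq> {1..<n} - {m}"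
  shows "hecke_class n (Poly_Mapping.single w c) =
    hecke_class n (Poly_Mapping.single (filter (\<lambda>i. i < m) w @ filter (\<lambda>i. m < i) w) c)"
  using assms
proof (induction w)
  case (Cons i w)
  let ?u = "filter (\<lambda>i. i < m) w" and ?z = "filter (\<lambda>i. m < i) w"
  have "hecke_class n (Poly_Mapping.single ([i] @ w) c) =
      hecke_class n (Poly_Mapping.single ([i] @ ?u @ ?z) c)"
    using Cons by (intro hecke_class_word_cong) auto
  also have "\<dots> = hecke_class n (Poly_Mapping.single (if m < i then ?u @ i # ?z else i # ?u @ ?z) c)"
  proof -
    have "set ?u \<subseteq> {1..<m}" "set ?z \<subseteq> {1..<n}" "i < n" using Cons.prems by auto
    then show ?thesis using hecke_class_move_letter[of m i n ?u ?z c] by simp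
  qed
  also have "(if m < i then ?u @ i # ?z else i # ?u @ ?z) =
      filter (\<lambda>i. i < m) (i # w) @ filter (\<lambda>i. m < i) (i # w)"
    using Cons.prems by auto
  finally show ?case by simp
qed simp

abbreviation embed_prod :: "nat \<Rightarrow> nat \<Rightarrow> hecke_elem \<Rightarrow> hecke_elem \<Rightarrow> hecke_elem" where
  "embed_prod m n a b \<equiv> hecke_embed 0 m n a \<otimes>\<^bsub>hecke n\<^esub> hecke_embed m (n - m) n b"

lemma embed_prod_class:
  assumes "m \<le> n" "f \<in> carrier (free_alg m)" "g \<in> carrier (free_alg (n - m))"
  shows "f * shift_letters m g \<in> carrier (free_alg n)"
    and "embed_prod m n (hecke_class m f) (hecke_class (n - m) g) = hecke_class n (f * shift_letters m g)"
proof -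
  have "f \<in> carrier (free_alg n)" "shift_letters m g \<in> carrier (free_alg n)"
    using shift_letters_closed[OF assms(2), of 0 n] shift_letters_closed[OF assms(3), of m n] assms(1)
    by simp_all
  then show "f * shift_letters m g \<in> carrier (free_alg n)"
    and "embed_prod m n (hecke_class m f) (hecke_class (n - m) g) = hecke_class n (f * shift_letters m g)"
    using assms by (simp_all add: hecke_embed_class hecke_class_mult free_alg_closed)
qed

lemma hecke_class_sum:
  assumes "finite K" "\<And>k. k \<in> K \<Longrightarrow> h k \<in> carrier (free_alg n)"
  shows "hecke_class n (\<Sum>k\<in>K. h k) = (\<Oplus>\<^bsub>hecke n\<^esub>k\<in>K. hecke_class n (h k))"
  using assms
proof (induction K rule: finite_induct)
  case empty
  interpret ring "hecke n" by (rule ring_hecke)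
  show ?case by (simp add: hecke_class_zero)
next
  case (insert k K)
  interpret ring "hecke n" by (rule ring_hecke)
  have "sum h K \<in> carrier (free_alg n)"
    using insert.prems words_in_sum[of K h] by (simp add: carrier_free_alg)
  with insert show ?case
    by (simp add: hecke_class_add hecke_class_closed)
qed

text \<open>This provides a candidate for the action on \<open>tensor_module\<close>: a word without
  \<open>m\<close> splits into its letters below and above \<open>m\<close> and gives one product of
  embedded elements.\<close>

lemma hecke_tensor_decompose:
  assumes m: "m \<le> n" and x: "x \<in> carrier (hecke_tensor m n)"
  obtains r a b where "\<forall>k<r :: nat. a k \<in> carrier (hecke m) \<and> b k \<in> carrier (hecke (n - m))"
    "x = (\<Oplus>\<^bsub>hecke n\<^esub>k\<in>{..<r}. embed_prod m n (a k) (b k))"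
proof -
  obtain f where f: "f \<in> words_in ({1..<n} - {m})" and x: "x = hecke_class n f"
    using x hecke_subalgebra_class[of "{1..<n} - {m}" n x] unfolding hecke_tensor_def by blast
  \<comment> \<open>The definition of the action sums over \<open>k < r\<close>, so the support is
    enumerated by an initial segment of the naturals.\<close>
  obtain h where h: "bij_betw h {..<card (Poly_Mapping.keys f)} (Poly_Mapping.keys f)"
    using ex_bij_betw_nat_finite[OF finite_keys, of f] by (auto simp: atLeast0LessThan)
  \<comment> \<open>The coefficient goes to the left factor, and the large letters are lowered by
    \<open>m\<close> because \<open>hecke_embed m\<close> raises them again.\<close>
  define F where "F w = Poly_Mapping.single (filter (\<lambda>i. i < m) w) (Poly_Mapping.lookup f w)" for w
  define E where "E w = Poly_Mapping.single (map (\<lambda>i. i - m) (filter (\<lambda>i. m < i) w)) (1 :: complex)" for w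
  have F: "F w \<in> carrier (free_alg m)" and E: "E w \<in> carrier (free_alg (n - m))"
    and term_eq: "hecke_class n (Poly_Mapping.single w (Poly_Mapping.lookup f w)) =
      embed_prod m n (hecke_class m (F w)) (hecke_class (n - m) (E w))"
    if "w \<in> Poly_Mapping.keys f" for w
  proof -
    have w: "set w \<subseteq> {1..<n} - {m}" using f that by (simp add: words_in_def)
    show F: "F w \<in> carrier (free_alg m)"
      unfolding F_def using w by (intro free_alg_closed) auto
    show E: "E w \<in> carrier (free_alg (n - m))"
    proof -
      have "i - m \<in> {1..<n - m}" if "i \<in> set w" "m < i" for i
        using w that by (auto dest!: subsetD)
      then show ?thesis
        unfolding E_def by (intro free_alg_closed) auto
    qed
    \<comment> \<open>The letters kept by the filter exceed \<open>m\<close>, so adding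
      \<open>m\<close> undoes the truncated subtraction.\<close>
    have "map (\<lambda>i. i + m) (map (\<lambda>i. i - m) (filter (\<lambda>i. m < i) w)) = filter (\<lambda>i. m < i) w"
      by (simp add: o_def) (rule map_idI, simp)
    then have "F w * shift_letters m (E w) =
        Poly_Mapping.single (filter (\<lambda>i. i < m) w @ filter (\<lambda>i. m < i) w) (Poly_Mapping.lookup f w)"
      by (simp add: F_def E_def mult_single plus_list_def del: map_map)
    then show "hecke_class n (Poly_Mapping.single w (Poly_Mapping.lookup f w)) =
        embed_prod m n (hecke_class m (F w)) (hecke_class (n - m) (E w))"
      using hecke_class_sort_word[OF w] embed_prod_class(2)[OF m F E] by simp
  qed
  have h_mem: "h k \<in> Poly_Mapping.keys f" if "k < card (Poly_Mapping.keys f)" for k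
    using h that by (auto simp: bij_betw_def)
  have "f = (\<Sum>k<card (Poly_Mapping.keys f). Poly_Mapping.single (h k) (Poly_Mapping.lookup f (h k)))"
    using sum.reindex_bij_betw[OF h, of "\<lambda>w. Poly_Mapping.single w (Poly_Mapping.lookup f w)"]
      poly_mapping_sum_single[of f] by simp
  moreover have "Poly_Mapping.single w (Poly_Mapping.lookup f w) \<in> carrier (free_alg n)"
    if "w \<in> Poly_Mapping.keys f" for w
    using f that by (intro free_alg_closed) (auto simp: words_in_def)
  ultimately have "x = (\<Oplus>\<^bsub>hecke n\<^esub>k\<in>{..<card (Poly_Mapping.keys f)}.
      hecke_class n (Poly_Mapping.single (h k) (Poly_Mapping.lookup f (h k))))"
    unfolding x using h_mem by (subst hecke_class_sum[symmetric]) auto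
  also have "\<dots> = (\<Oplus>\<^bsub>hecke n\<^esub>k\<in>{..<card (Poly_Mapping.keys f)}.
      embed_prod m n (hecke_class m (F (h k))) (hecke_class (n - m) (E (h k))))"
  proof (rule abelian_monoid.finsum_cong')
    show "abelian_monoid (hecke n)"
      using ring_hecke[of n] by (simp add: ring_def abelian_group_def)
  qed (use h_mem term_eq embed_prod_class[OF m F E] hecke_class_closed in auto)
  finally show thesis
    using that[of "card (Poly_Mapping.keys f)" "\<lambda>k. hecke_class m (F (h k))"
        "\<lambda>k. hecke_class (n - m) (E (h k))"] h_mem F E hecke_class_closed by blast
qed


section \<open>Tensor products\<close>

lemma pure_tensor_altdef:
  "pure_tensor v w = linear_extension (\<lambda>x. linear_extension (\<lambda>y. Poly_Mapping.single (x, y) 1) w) v"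
  by (simp add: pure_tensor_def linear_extension_def scale_sum_right)

lemma linear_op_pure_tensor_left: "linear_op (\<lambda>v. pure_tensor v w)"
  using linear_op_linear_extension by (simp add: pure_tensor_altdef)

lemma linear_op_pure_tensor_right: "linear_op (pure_tensor v)"
  by (rule linear_opI)
     (simp_all add: pure_tensor_altdef linear_extension_add linear_extension_fun_add
        linear_op_scale[OF linear_op_linear_extension] linear_extension_fun_scale)

lemma pure_tensor_single [simp]:
  "pure_tensor (Poly_Mapping.single x c) (Poly_Mapping.single y d) = Poly_Mapping.single (x, y) (c * d)"
  by (simp add: pure_tensor_altdef)

lemma keys_pure_tensor:
  assumes "Poly_Mapping.keys v \<subseteq> A" "Poly_Mapping.keys w \<subseteq> B"
  shows "Poly_Mapping.keys (pure_tensor v w) \<subseteq> A \<times> B"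
  unfolding pure_tensor_altdef using assms by (intro keys_linear_extension) auto

text \<open>Tensoring with a basis element turns a relabelling of pairs into one of first
  components, the form in which \<open>pi_tableau_glue_straight\<close> is stated.\<close>

lemma relabel_pure_tensor_single_right:
  "relabel (\<lambda>(x, y). g x y) (pure_tensor v (Poly_Mapping.single y 1)) = relabel (\<lambda>x. g x y) v"
  by (rule linear_op_eqI[OF linear_op_comp[OF linear_op_relabel linear_op_pure_tensor_left]
        linear_op_relabel subset_UNIV]) simp

lemma relabel_pure_tensor_single_left:
  "relabel (\<lambda>(x, y). g x y) (pure_tensor (Poly_Mapping.single x 1) w) = relabel (g x) w"
  by (rule linear_op_eqI[OF linear_op_comp[OF linear_op_relabel linear_op_pure_tensor_right]
        linear_op_relabel subset_UNIV]) simp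

text \<open>Each term of \<open>t\<close> is a pure tensor of basis elements, with its coefficient
  put into the left factor.\<close>

lemma sum_pure_tensors:
  fixes t :: "'x \<times> 'y \<Rightarrow>\<^sub>0 complex"
  assumes "Poly_Mapping.keys t \<subseteq> A \<times> B"
  obtains s v w where "\<forall>l<s :: nat. Poly_Mapping.keys (v l) \<subseteq> A \<and> Poly_Mapping.keys (w l) \<subseteq> B"
    "t = (\<Sum>l<s. pure_tensor (v l) (w l))"
proof -
  obtain h where h: "bij_betw h {..<card (Poly_Mapping.keys t)} (Poly_Mapping.keys t)"
    using ex_bij_betw_nat_finite[OF finite_keys, of t] by (auto simp: atLeast0LessThan)
  then have mem: "h l \<in> A \<times> B" if "l < card (Poly_Mapping.keys t)" for l
    using that assms by (auto simp: bij_betw_def)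
  have "t = (\<Sum>l<card (Poly_Mapping.keys t). Poly_Mapping.single (h l) (Poly_Mapping.lookup t (h l)))"
    using sum.reindex_bij_betw[OF h, of "\<lambda>p. Poly_Mapping.single p (Poly_Mapping.lookup t p)"]
      poly_mapping_sum_single[of t] by simp
  then have "t = (\<Sum>l<card (Poly_Mapping.keys t). pure_tensor
      (Poly_Mapping.single (fst (h l)) (Poly_Mapping.lookup t (h l))) (Poly_Mapping.single (snd (h l)) 1))"
    by simp
  with mem show thesis
    by (intro that[of "card (Poly_Mapping.keys t)"
          "\<lambda>l. Poly_Mapping.single (fst (h l)) (Poly_Mapping.lookup t (h l))"
          "\<lambda>l. Poly_Mapping.single (snd (h l)) 1"]) (auto simp: mem_Times_iff)
qed

lemma tensor_module_simps [simp]: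
  "\<zero>\<^bsub>tensor_module m n V W\<^esub> = 0" "s \<oplus>\<^bsub>tensor_module m n V W\<^esub> t = s + t"
  by (simp_all add: tensor_module_def)

text \<open>The tensor product of the spans of \<open>A\<close> and \<open>B\<close> has the pairs
  as a basis, as \<open>module_isomorphic_direct_sum\<close> asks of each summand.\<close>

lemma carrier_tensor_module:
  fixes A :: "'x set" and B :: "'y set"
  assumes V: "carrier V = {v. Poly_Mapping.keys v \<subseteq> A}" and W: "carrier W = {w. Poly_Mapping.keys w \<subseteq> B}"
  shows "carrier (tensor_module m n V W) = {t :: 'x \<times> 'y \<Rightarrow>\<^sub>0 complex. Poly_Mapping.keys t \<subseteq> A \<times> B}"
proof (intro equalityI subsetI; unfold mem_Collect_eq)
  fix t assume "t \<in> carrier (tensor_module m n V W)"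
  then obtain s :: nat and v w where t: "t = (\<Sum>l<s. pure_tensor (v l) (w l))"
    and "\<forall>l<s. v l \<in> carrier V \<and> w l \<in> carrier W"
    by (auto simp: tensor_module_def)
  then have "Poly_Mapping.keys (pure_tensor (v l) (w l)) \<subseteq> A \<times> B" if "l < s" for l
    using that V W by (intro keys_pure_tensor) auto
  then show "Poly_Mapping.keys t \<subseteq> A \<times> B"
    unfolding t using keys_sum[of "\<lambda>l. pure_tensor (v l) (w l)" "{..<s}"] by fast
next
  fix t :: "'x \<times> 'y \<Rightarrow>\<^sub>0 complex"
  assume "Poly_Mapping.keys t \<subseteq> A \<times> B"
  then obtain s :: nat and v w where "\<forall>l<s. Poly_Mapping.keys (v l) \<subseteq> A \<and> Poly_Mapping.keys (w l) \<subseteq> B"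
    and "t = (\<Sum>l<s. pure_tensor (v l) (w l))"
    using sum_pure_tensors by blast
  then show "t \<in> carrier (tensor_module m n V W)"
    using V W by (auto simp: tensor_module_def)
qed

lemma left_module_finsum_smult:
  fixes V :: "('a, 'b :: ab_group_add) module" and r :: nat
  assumes V: "left_module R V" "\<And>x y. x \<oplus>\<^bsub>V\<^esub> y = x + y"
    and "v \<in> carrier V" "\<And>k. k < r \<Longrightarrow> h k \<in> carrier R"
  shows "(\<Oplus>\<^bsub>R\<^esub>k\<in>{..<r}. h k) \<odot>\<^bsub>V\<^esub> v = (\<Sum>k<r. h k \<odot>\<^bsub>V\<^esub> v)"
  using assms(4)
proof (induction r)
  case 0
  interpret V: left_module R V by (rule V(1))
  show ?case
    using V.smult_l_distr[OF V.R.zero_closed V.R.zero_closed assms(3)] by (simp add: V(2))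
next
  case (Suc r)
  interpret V: left_module R V by (rule V(1))
  have "(\<Oplus>\<^bsub>R\<^esub>k\<in>{..<r}. h k) \<in> carrier R"
    using Suc.prems by (intro V.R.finsum_closed) auto
  moreover have "(\<Oplus>\<^bsub>R\<^esub>k\<in>{..<Suc r}. h k) = h r \<oplus>\<^bsub>R\<^esub> (\<Oplus>\<^bsub>R\<^esub>k\<in>{..<r}. h k)"
    using Suc.prems by (simp add: lessThan_Suc Pi_def)
  ultimately show ?case
    using Suc V.smult_l_distr[of "h r" "\<Oplus>\<^bsub>R\<^esub>k\<in>{..<r}. h k" v] assms(3) by (simp add: V(2) add.commute)
qed

section \<open>The embedding of one summand into the module of \<alpha>\<close>

context contained_composition
begin

abbreviation \<iota> where "\<iota> \<equiv> relabel (\<lambda>(T, U). G T U)"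

lemma linear_op_\<iota>_left: "linear_op (\<lambda>v. \<iota> (pure_tensor v w))"
  and linear_op_\<iota>_right: "linear_op (\<lambda>w. \<iota> (pure_tensor v w))"
  by (rule linear_op_comp[OF linear_op_relabel linear_op_pure_tensor_left]
        linear_op_comp[OF linear_op_relabel linear_op_pure_tensor_right])+

lemma inj_on_glue: "inj_on (\<lambda>(T, U). G T U) (SIT \<beta> [] \<times> SIT \<alpha> \<beta>)"
  by (rule inj_onI) (auto dest: glue_inject)

lemma keys_\<iota>: "Poly_Mapping.keys t \<subseteq> SIT \<beta> [] \<times> SIT \<alpha> \<beta> \<Longrightarrow> Poly_Mapping.keys (\<iota> t) \<subseteq> SIT \<alpha> []"
  using keys_relabel[of "\<lambda>(T, U). G T U" t] glue_SIT by fastforce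

text \<open>For fixed \<open>w\<close>, tensoring and gluing is linear in \<open>v\<close>, so
  \<open>free_action_intertwine\<close> reduces the claim to one letter and one tableau; linearity
  in \<open>w\<close> then reduces it to gluing two tableaux.\<close>

lemma \<iota>_free_action_left:
  assumes v: "Poly_Mapping.keys v \<subseteq> SIT \<beta> []" and w: "Poly_Mapping.keys w \<subseteq> SIT \<alpha> \<beta>"
    and f: "f \<in> carrier (free_alg m)"
  shows "\<iota> (pure_tensor (free_action (diagram \<beta>) f v) w) = free_action (diagram \<alpha>) f (\<iota> (pure_tensor v w))"
proof -
  have "\<iota> (pure_tensor (free_action (diagram \<beta>) f v) w) =
      free_action (diagram \<alpha>) (shift_letters 0 f) (\<iota> (pure_tensor v w))"
  proof (rule free_action_intertwine(2)[OF linear_op_\<iota>_left _ _ v f])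
    fix T i assume T: "T \<in> SIT \<beta> []" and i: "i \<in> {1..<m}"
    then show "Poly_Mapping.keys (pi_tableau (diagram \<beta>) i T) \<subseteq> SIT \<beta> []"
      using keys_pi_tableau[of T \<beta> "[]" i] by simp
    have "\<iota> (pure_tensor (pi_tableau (diagram \<beta>) i T) w) =
        letter_op (diagram \<alpha>) i (\<iota> (pure_tensor (Poly_Mapping.single T 1) w))"
      by (rule linear_op_eqI[OF linear_op_\<iota>_right
            linear_op_comp[OF linear_op_linear_extension linear_op_\<iota>_right] w])
         (simp add: relabel_pure_tensor_single_right pi_tableau_glue_straight[OF T _ i])
    then show "\<iota> (pure_tensor (pi_tableau (diagram \<beta>) i T) w) =
        letter_op (diagram \<alpha>) (i + 0) (\<iota> (pure_tensor (Poly_Mapping.single T 1) w))"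
      by simp
  qed
  then show ?thesis by simp
qed

lemma \<iota>_free_action_right:
  assumes v: "Poly_Mapping.keys v \<subseteq> SIT \<beta> []" and w: "Poly_Mapping.keys w \<subseteq> SIT \<alpha> \<beta>"
    and f: "f \<in> carrier (free_alg (n - m))"
  shows "\<iota> (pure_tensor v (free_action (skew_diagram \<alpha> \<beta>) f w)) =
    free_action (diagram \<alpha>) (shift_letters m f) (\<iota> (pure_tensor v w))"
proof (rule free_action_intertwine(2)[OF linear_op_\<iota>_right _ _ w f])
  fix U i assume U: "U \<in> SIT \<alpha> \<beta>" and i: "i \<in> {1..<n - m}"
  then show "Poly_Mapping.keys (pi_tableau (skew_diagram \<alpha> \<beta>) i U) \<subseteq> SIT \<alpha> \<beta>"
    using keys_pi_tableau[of U \<alpha> \<beta> i] by simp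
  show "\<iota> (pure_tensor v (pi_tableau (skew_diagram \<alpha> \<beta>) i U)) =
      letter_op (diagram \<alpha>) (i + m) (\<iota> (pure_tensor v (Poly_Mapping.single U 1)))"
    by (rule linear_op_eqI[OF linear_op_\<iota>_left
          linear_op_comp[OF linear_op_linear_extension linear_op_\<iota>_left] v])
       (simp add: relabel_pure_tensor_single_left pi_tableau_glue_skew[OF _ U i])
qed

lemma \<iota>_embed_prod:
  assumes v: "v \<in> carrier (tableau_module \<beta> [])" and w: "w \<in> carrier (tableau_module \<alpha> \<beta>)"
    and a: "a \<in> carrier (hecke m)" and b: "b \<in> carrier (hecke (n - m))"
  shows "\<iota> (pure_tensor (a \<odot>\<^bsub>tableau_module \<beta> []\<^esub> v) (b \<odot>\<^bsub>tableau_module \<alpha> \<beta>\<^esub> w)) =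
    embed_prod m n a b \<odot>\<^bsub>tableau_module \<alpha> []\<^esub> \<iota> (pure_tensor v w)"
proof -
  obtain f g where f: "f \<in> carrier (free_alg m)" "a = hecke_class m f"
    and g: "g \<in> carrier (free_alg (n - m))" "b = hecke_class (n - m) g"
    using a b by (auto simp: carrier_hecke)
  have vw: "Poly_Mapping.keys v \<subseteq> SIT \<beta> []" "Poly_Mapping.keys w \<subseteq> SIT \<alpha> \<beta>"
    using v w by simp_all
  have gw: "Poly_Mapping.keys (free_action (skew_diagram \<alpha> \<beta>) g w) \<subseteq> SIT \<alpha> \<beta>"
    using keys_free_action[of w \<alpha> \<beta> g] vw g by simp
  have "embed_prod m n a b \<odot>\<^bsub>tableau_module \<alpha> []\<^esub> \<iota> (pure_tensor v w) =
      free_action (diagram \<alpha>) (f * shift_letters m g) (\<iota> (pure_tensor v w))"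
    using tableau_module_smult[of "f * shift_letters m g" \<alpha> "[]" "\<iota> (pure_tensor v w)"]
      embed_prod_class[OF m_le_n f(1) g(1)] f g keys_\<iota>[OF keys_pure_tensor[OF vw]] by simp
  \<comment> \<open>In the product the shifted \<open>g\<close> acts first and moves only the skew
    factor. By \<open>gw\<close> the result is again supported on skew tableaux, so \<open>f\<close>
    can then act on the straight factor.\<close>
  also have "\<dots> = \<iota> (pure_tensor (free_action (diagram \<beta>) f v) (free_action (skew_diagram \<alpha> \<beta>) g w))"
    using \<iota>_free_action_left[OF vw(1) gw f(1)] \<iota>_free_action_right[OF vw g(1)]
    by (simp add: free_action_mult)
  also have "\<dots> = \<iota> (pure_tensor (a \<odot>\<^bsub>tableau_module \<beta> []\<^esub> v) (b \<odot>\<^bsub>tableau_module \<alpha> \<beta>\<^esub> w))"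
    using tableau_module_smult[of f \<beta> "[]" v] tableau_module_smult[of g \<alpha> \<beta> w] f g vw by simp
  finally show ?thesis ..
qed

lemma left_module_\<alpha>: "left_module (hecke n) (tableau_module \<alpha> [])"
  using left_module_tableau_module[of \<alpha> "[]"] by simp

lemma left_module_\<beta>: "left_module (hecke m) (tableau_module \<beta> [])"
  using left_module_tableau_module[of \<beta> "[]"] by simp

lemma left_module_skew: "left_module (hecke (n - m)) (tableau_module \<alpha> \<beta>)"
  using left_module_tableau_module[of \<alpha> \<beta>] by simp

lemma carrier_tensor:
  "carrier (tensor_module m n (tableau_module \<beta> []) (tableau_module \<alpha> \<beta>)) =
    {t. Poly_Mapping.keys t \<subseteq> SIT \<beta> [] \<times> SIT \<alpha> \<beta>}"
  by (rule carrier_tensor_module) simp_all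

text \<open>The embedding \<open>\<iota>\<close> into the module of \<open>\<alpha>\<close> shows that the defining set of the action on the
  tensor product has only one element; the tensor product of the algebras is never needed.\<close>

lemma tensor_smult:
  assumes x: "x \<in> carrier (hecke_tensor m n)"
    and t: "Poly_Mapping.keys t \<subseteq> SIT \<beta> [] \<times> SIT \<alpha> \<beta>"
  shows "Poly_Mapping.keys (x \<odot>\<^bsub>tensor_module m n (tableau_module \<beta> []) (tableau_module \<alpha> \<beta>)\<^esub> t)
      \<subseteq> SIT \<beta> [] \<times> SIT \<alpha> \<beta>"
    and "\<iota> (x \<odot>\<^bsub>tensor_module m n (tableau_module \<beta> []) (tableau_module \<alpha> \<beta>)\<^esub> t) =
      x \<odot>\<^bsub>tableau_module \<alpha> []\<^esub> \<iota> t"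
proof -
  let ?V = "tableau_module \<beta> []" and ?W = "tableau_module \<alpha> \<beta>"
  let ?Y = "{\<Sum>k<r. \<Sum>l<s. pure_tensor (a k \<odot>\<^bsub>?V\<^esub> v l) (b k \<odot>\<^bsub>?W\<^esub> w l) | (r :: nat) a b (s :: nat) v w.
    (\<forall>k<r. a k \<in> carrier (hecke m) \<and> b k \<in> carrier (hecke (n - m))) \<and>
    x = (\<Oplus>\<^bsub>hecke n\<^esub>k\<in>{..<r}. embed_prod m n (a k) (b k)) \<and>
    (\<forall>l<s. v l \<in> carrier ?V \<and> w l \<in> carrier ?W) \<and> t = (\<Sum>l<s. pure_tensor (v l) (w l))}"
  interpret A: left_module "hecke n" "tableau_module \<alpha> []" by (rule left_module_\<alpha>)
  interpret V: left_module "hecke m" ?V by (rule left_module_\<beta>)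
  interpret W: left_module "hecke (n - m)" ?W by (rule left_module_skew)
  have rep: "Poly_Mapping.keys y \<subseteq> SIT \<beta> [] \<times> SIT \<alpha> \<beta> \<and> \<iota> y = x \<odot>\<^bsub>tableau_module \<alpha> []\<^esub> \<iota> t"
    if y: "y = (\<Sum>k<r. \<Sum>l<s. pure_tensor (a k \<odot>\<^bsub>?V\<^esub> v l) (b k \<odot>\<^bsub>?W\<^esub> w l))"
      and ab: "\<forall>k<r. a k \<in> carrier (hecke m) \<and> b k \<in> carrier (hecke (n - m))"
      and x: "x = (\<Oplus>\<^bsub>hecke n\<^esub>k\<in>{..<r}. embed_prod m n (a k) (b k))"
      and vw: "\<forall>l<s. v l \<in> carrier ?V \<and> w l \<in> carrier ?W"
      and t_eq: "t = (\<Sum>l<s. pure_tensor (v l) (w l))"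
    for y and r s :: nat and a b v w
  proof -
    have keys: "Poly_Mapping.keys (pure_tensor (a k \<odot>\<^bsub>?V\<^esub> v l) (b k \<odot>\<^bsub>?W\<^esub> w l)) \<subseteq> SIT \<beta> [] \<times> SIT \<alpha> \<beta>"
      if "k < r" "l < s" for k l
      using V.smult_closed[of "a k" "v l"] W.smult_closed[of "b k" "w l"] ab vw that
      by (intro keys_pure_tensor) auto
    have "Poly_Mapping.keys y \<subseteq> (\<Union>k\<in>{..<r}. Poly_Mapping.keys
        (\<Sum>l<s. pure_tensor (a k \<odot>\<^bsub>?V\<^esub> v l) (b k \<odot>\<^bsub>?W\<^esub> w l)))"
      unfolding y by (rule keys_sum)
    also have "\<dots> \<subseteq> (\<Union>k\<in>{..<r}. \<Union>l\<in>{..<s}. Poly_Mapping.keys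
        (pure_tensor (a k \<odot>\<^bsub>?V\<^esub> v l) (b k \<odot>\<^bsub>?W\<^esub> w l)))"
      by (intro UN_mono keys_sum) auto
    also have "\<dots> \<subseteq> SIT \<beta> [] \<times> SIT \<alpha> \<beta>"
      using keys by fast
    finally have keys_y: "Poly_Mapping.keys y \<subseteq> SIT \<beta> [] \<times> SIT \<alpha> \<beta>" .
    have emb: "embed_prod m n (a k) (b k) \<in> carrier (hecke n)" if k: "k < r" for k
    proof -
      obtain f g where "f \<in> carrier (free_alg m)" "a k = hecke_class m f"
        "g \<in> carrier (free_alg (n - m))" "b k = hecke_class (n - m) g"
        using ab k unfolding carrier_hecke by blast
      then show ?thesis
        using embed_prod_class[OF m_le_n] by (simp add: hecke_class_closed)
    qed
    have \<iota>_mem: "\<iota> (pure_tensor (v l) (w l)) \<in> carrier (tableau_module \<alpha> [])" if "l < s" for l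
      using vw that keys_\<iota>[OF keys_pure_tensor] by simp
    have \<iota>t: "\<iota> t \<in> carrier (tableau_module \<alpha> [])"
      using keys_\<iota>[OF t] by simp
    have "x \<odot>\<^bsub>tableau_module \<alpha> []\<^esub> \<iota> t =
        (\<Sum>k<r. embed_prod m n (a k) (b k) \<odot>\<^bsub>tableau_module \<alpha> []\<^esub> \<iota> t)"
      unfolding x by (rule left_module_finsum_smult[OF left_module_\<alpha> _ \<iota>t]) (simp_all add: emb)
    also have "\<dots> = (\<Sum>k<r. \<Sum>l<s. embed_prod m n (a k) (b k) \<odot>\<^bsub>tableau_module \<alpha> []\<^esub>
        \<iota> (pure_tensor (v l) (w l)))"
    proof (rule sum.cong[OF refl])
      fix k assume "k \<in> {..<r}"
      then show "embed_prod m n (a k) (b k) \<odot>\<^bsub>tableau_module \<alpha> []\<^esub> \<iota> t =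
          (\<Sum>l<s. embed_prod m n (a k) (b k) \<odot>\<^bsub>tableau_module \<alpha> []\<^esub> \<iota> (pure_tensor (v l) (w l)))"
        unfolding t_eq linear_op_sum[OF linear_op_relabel] using emb \<iota>_mem
        by (intro left_module_smult_sum[OF left_module_\<alpha>]) auto
    qed
    also have "\<dots> = \<iota> y"
      unfolding y linear_op_sum[OF linear_op_relabel]
      by (intro sum.cong refl \<iota>_embed_prod[symmetric]) (use ab vw in auto)
    finally show ?thesis using keys_y by simp
  qed
  have rep_Y: "Poly_Mapping.keys y \<subseteq> SIT \<beta> [] \<times> SIT \<alpha> \<beta> \<and> \<iota> y = x \<odot>\<^bsub>tableau_module \<alpha> []\<^esub> \<iota> t"
    if "y \<in> ?Y" for y
    using that by (elim CollectE exE conjE) (rule rep)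
  \<comment> \<open>A candidate exists: it is built from one decomposition of \<open>x\<close> and
    one of \<open>t\<close>.\<close>
  obtain r :: nat and a b
    where ab: "\<forall>k<r. a k \<in> carrier (hecke m) \<and> b k \<in> carrier (hecke (n - m))"
      "x = (\<Oplus>\<^bsub>hecke n\<^esub>k\<in>{..<r}. embed_prod m n (a k) (b k))"
    using hecke_tensor_decompose[OF m_le_n x] .
  obtain s :: nat and v w
    where "\<forall>l<s. Poly_Mapping.keys (v l) \<subseteq> SIT \<beta> [] \<and> Poly_Mapping.keys (w l) \<subseteq> SIT \<alpha> \<beta>"
      and t_eq: "t = (\<Sum>l<s. pure_tensor (v l) (w l))"
    using sum_pure_tensors[OF t] .
  then have vw: "\<forall>l<s. v l \<in> carrier ?V \<and> w l \<in> carrier ?W" by simp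
  define y where "y = (\<Sum>k<r. \<Sum>l<s. pure_tensor (a k \<odot>\<^bsub>?V\<^esub> v l) (b k \<odot>\<^bsub>?W\<^esub> w l))"
  have y: "y \<in> ?Y"
    unfolding y_def
    by (intro CollectI exI conjI, rule refl) (use ab vw t_eq in auto)
  have "z = y" if "z \<in> ?Y" for z
    using rep_Y[OF that] rep_Y[OF y] by (intro relabel_inj[OF inj_on_glue]) auto
  with y have "?Y = {y}" by blast
  then have "x \<odot>\<^bsub>tensor_module m n ?V ?W\<^esub> t = y"
    by (simp add: tensor_module_def)
  with rep_Y[OF y]
  show "Poly_Mapping.keys (x \<odot>\<^bsub>tensor_module m n ?V ?W\<^esub> t) \<subseteq> SIT \<beta> [] \<times> SIT \<alpha> \<beta>"
    and "\<iota> (x \<odot>\<^bsub>tensor_module m n ?V ?W\<^esub> t) = x \<odot>\<^bsub>tableau_module \<alpha> []\<^esub> \<iota> t"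
    by simp_all
qed

end

section \<open>Restriction\<close>

lemma left_module_restrict:
  assumes "is_composition \<alpha> n" "J \<subseteq> {1..<n}"
  shows "left_module (hecke_subalgebra n J) (tableau_module \<alpha> [])"
proof -
  have "left_module (hecke n) (tableau_module \<alpha> [])"
    using left_module_tableau_module[of \<alpha> "[]"] assms(1) by (simp add: is_composition_def)
  then show ?thesis
    by (subst hecke_subalgebra_altdef) (rule left_module_subring[OF _ subring_hecke_subalgebra[OF assms(2)]])
qed

lemma restrict_tensor:
  assumes \<alpha>: "is_composition \<alpha> n" and m: "m \<le> n"
  shows "module_isomorphic (hecke_tensor m n) (tableau_module \<alpha> [])
    (direct_sum {\<beta>. is_composition \<beta> m \<and> comp_contained \<beta> \<alpha>}
      (\<lambda>\<beta>. tensor_module m n (tableau_module \<beta> []) (tableau_module \<alpha> \<beta>)))"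
proof (rule module_isomorphic_direct_sum[where S = "SIT \<alpha> []" and T = "\<lambda>\<beta>. SIT \<beta> [] \<times> SIT \<alpha> \<beta>"
      and g = "\<lambda>\<beta> (T, U). glue \<alpha> \<beta> m T U"])
  show "left_module (hecke_tensor m n) (tableau_module \<alpha> [])"
    unfolding hecke_tensor_def by (rule left_module_restrict[OF \<alpha>]) auto
  show "finite {\<beta>. is_composition \<beta> m \<and> comp_contained \<beta> \<alpha>}"
    by (rule finite_contained_compositions)
  show "bij_betw (\<lambda>(\<beta>, p). case p of (T, U) \<Rightarrow> glue \<alpha> \<beta> m T U)
      (SIGMA \<beta>:{\<beta>. is_composition \<beta> m \<and> comp_contained \<beta> \<alpha>}. SIT \<beta> [] \<times> SIT \<alpha> \<beta>) (SIT \<alpha> [])"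
    by (rule bij_betw_glue[OF \<alpha> m])
next
  fix \<beta> assume "\<beta> \<in> {\<beta>. is_composition \<beta> m \<and> comp_contained \<beta> \<alpha>}"
  then interpret contained_composition \<alpha> \<beta> n m
    using \<alpha> by unfold_locales auto
  show "carrier (tensor_module m n (tableau_module \<beta> []) (tableau_module \<alpha> \<beta>)) =
      {t. Poly_Mapping.keys t \<subseteq> SIT \<beta> [] \<times> SIT \<alpha> \<beta>}"
    by (rule carrier_tensor)
  fix x t
  assume "x \<in> carrier (hecke_tensor m n)"
    and "t \<in> carrier (tensor_module m n (tableau_module \<beta> []) (tableau_module \<alpha> \<beta>))"
  then show "x \<odot>\<^bsub>tensor_module m n (tableau_module \<beta> []) (tableau_module \<alpha> \<beta>)\<^esub> t
        \<in> carrier (tensor_module m n (tableau_module \<beta> []) (tableau_module \<alpha> \<beta>)) \<and>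
      \<iota> (x \<odot>\<^bsub>tensor_module m n (tableau_module \<beta> []) (tableau_module \<alpha> \<beta>)\<^esub> t) =
        x \<odot>\<^bsub>tableau_module \<alpha> []\<^esub> \<iota> t"
    using tensor_smult[of x t] unfolding carrier_tensor by blast
qed simp_all

text \<open>Sizes decide both equations: a composition of \<open>n - 1\<close> differs from one of
  \<open>n\<close>, and a single missing cell means that the size drops by one. For
  \<open>n = 0\<close> truncated subtraction would make the sizes equal, whence
  \<open>1 \<le> n\<close>.\<close>

lemma contained_compositions_one_less:
  assumes "is_composition \<alpha> n" "1 \<le> n"
  shows "{\<beta>. is_composition \<beta> (n - 1) \<and> comp_contained \<beta> \<alpha> \<and> \<beta> \<noteq> \<alpha>} =
      {\<beta>. is_composition \<beta> (n - 1) \<and> comp_contained \<beta> \<alpha>}"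
    and "{\<beta>. is_composition \<beta> (n - 1) \<and> comp_contained \<beta> \<alpha> \<and> \<beta> \<noteq> \<alpha>} =
      {\<beta>. is_composition \<beta> (sum_list \<beta>) \<and> comp_contained \<beta> \<alpha> \<and> card (skew_diagram \<alpha> \<beta>) = 1}"
  using assms by (auto simp: is_composition_def card_skew_diagram)

text \<open>This makes the skew module one-dimensional, so that the pairs of a straight and a skew
  tableau reduce to their first components.\<close>

lemma SIT_single_cell:
  assumes "skew_diagram \<alpha> \<beta> = {c}" "sum_list \<alpha> - sum_list \<beta> = 1"
  shows "SIT \<alpha> \<beta> = {\<lambda>c\<in>skew_diagram \<alpha> \<beta>. 1}"
proof (intro equalityI subsetI)
  fix U assume "U \<in> SIT \<alpha> \<beta>"
  then have "U \<in> extensional {c}" "bij_betw U {c} {1}" using assms by (simp_all add: SIT_def)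
  then have "U = (\<lambda>c\<in>{c}. 1)"
    by (intro extensionalityI[of U "{c}"]) (auto simp: bij_betw_def)
  with assms show "U \<in> {\<lambda>c\<in>skew_diagram \<alpha> \<beta>. 1}" by simp
next
  fix U assume "U \<in> {\<lambda>c\<in>skew_diagram \<alpha> \<beta>. 1 :: nat}"
  with assms show "U \<in> SIT \<alpha> \<beta>" by (auto simp: SIT_def)
qed

text \<open>The action of \<open>x\<close> goes through a preimage under \<open>hecke_embed\<close>.
  Gluing with a fixed \<open>U\<close> is injective and turns the action of any preimage into that
  of \<open>x\<close> on the module of \<alpha>, so all preimages give the same value.\<close>

lemma transport_embed_smult:
  assumes \<alpha>: "is_composition \<alpha> n" and n: "1 \<le> n" and \<beta>: "is_composition \<beta> (n - 1)" "comp_contained \<beta> \<alpha>"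
    and U: "U \<in> SIT \<alpha> \<beta>"
    and x: "x \<in> carrier (hecke_subalgebra n {1..<n - 1})" and v: "Poly_Mapping.keys v \<subseteq> SIT \<beta> []"
  shows "Poly_Mapping.keys (x \<odot>\<^bsub>transport_embed (n - 1) n (tableau_module \<beta> [])\<^esub> v) \<subseteq> SIT \<beta> []"
    and "relabel (\<lambda>T. glue \<alpha> \<beta> (n - 1) T U) (x \<odot>\<^bsub>transport_embed (n - 1) n (tableau_module \<beta> [])\<^esub> v) =
      x \<odot>\<^bsub>tableau_module \<alpha> []\<^esub> relabel (\<lambda>T. glue \<alpha> \<beta> (n - 1) T U) v"
proof -
  interpret contained_composition \<alpha> \<beta> n "n - 1"
    using \<alpha> \<beta> by unfold_locales
  let ?Y = "{a \<odot>\<^bsub>tableau_module \<beta> []\<^esub> v | a. a \<in> carrier (hecke (n - 1)) \<and> hecke_embed 0 (n - 1) n a = x}"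
  let ?\<rho> = "relabel (\<lambda>T. G T U)"
  \<comment> \<open>The relabelling is the embedding \<open>\<iota>\<close> with the second factor
    fixed, so \<open>\<iota>_free_action_left\<close> applies to it.\<close>
  have \<rho>: "?\<rho> u = \<iota> (pure_tensor u (Poly_Mapping.single U 1))" for u
    by (rule relabel_pure_tensor_single_right[symmetric])
  have rep: "Poly_Mapping.keys (a \<odot>\<^bsub>tableau_module \<beta> []\<^esub> v) \<subseteq> SIT \<beta> [] \<and>
      ?\<rho> (a \<odot>\<^bsub>tableau_module \<beta> []\<^esub> v) = x \<odot>\<^bsub>tableau_module \<alpha> []\<^esub> ?\<rho> v"
    if a: "a \<in> carrier (hecke (n - 1))" "hecke_embed 0 (n - 1) n a = x" for a
  proof -
    obtain f where f: "f \<in> carrier (free_alg (n - 1))" "a = hecke_class (n - 1) f"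
      using a by (auto simp: carrier_hecke)
    have fn: "f \<in> carrier (free_alg n)"
      using shift_letters_closed[OF f(1), of 0 n] by simp
    have x: "x = hecke_class n f"
      using a hecke_embed_class[of "n - 1" 0 n f] f by simp
    have a_v: "a \<odot>\<^bsub>tableau_module \<beta> []\<^esub> v = free_action (diagram \<beta>) f v"
      using tableau_module_smult[of f \<beta> "[]" v] f v by simp
    have single: "Poly_Mapping.keys (Poly_Mapping.single U (1 :: complex)) \<subseteq> SIT \<alpha> \<beta>"
      using U by simp
    have "x \<odot>\<^bsub>tableau_module \<alpha> []\<^esub> ?\<rho> v = free_action (diagram \<alpha>) f (?\<rho> v)"
      unfolding \<rho> x using tableau_module_smult[of f \<alpha> "[]"] fn keys_\<iota>[OF keys_pure_tensor[OF v single]]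
      by simp
    also have "\<dots> = ?\<rho> (free_action (diagram \<beta>) f v)"
      unfolding \<rho> by (rule \<iota>_free_action_left[OF v single f(1), symmetric])
    finally show ?thesis
      unfolding a_v using keys_free_action[of v \<beta> "[]" f] v f(1) by simp
  qed
  \<comment> \<open>A preimage exists: \<open>x\<close> has a representative without the letter
    \<open>n - 1\<close>, which therefore lies in \<open>free_alg (n - 1)\<close>.\<close>
  have "{1..<n - 1} \<subseteq> {1..<n}" by auto
  then obtain f where f: "f \<in> words_in {1..<n - 1}" "x = hecke_class n f"
    using x by (rule hecke_subalgebra_class)
  define y where "y = hecke_class (n - 1) f \<odot>\<^bsub>tableau_module \<beta> []\<^esub> v"
  have f': "f \<in> carrier (free_alg (n - 1))" using f by (simp add: carrier_free_alg)
  then have x_eq: "hecke_embed 0 (n - 1) n (hecke_class (n - 1) f) = x"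
    using f hecke_embed_class[of "n - 1" 0 n f] by simp
  have y: "y \<in> ?Y"
    unfolding y_def by (intro CollectI exI conjI, rule refl) (use x_eq hecke_class_closed[OF f'] in blast)+
  have inj: "inj_on (\<lambda>T. G T U) (SIT \<beta> [])"
    using glue_inject(1)[OF _ U _ U] by (rule inj_onI)
  have rep_Y: "Poly_Mapping.keys z \<subseteq> SIT \<beta> [] \<and> ?\<rho> z = x \<odot>\<^bsub>tableau_module \<alpha> []\<^esub> ?\<rho> v"
    if "z \<in> ?Y" for z
    using that rep by blast
  have "z = y" if "z \<in> ?Y" for z
    by (rule relabel_inj[OF inj]) (simp_all only: rep_Y[OF that] rep_Y[OF y])
  with y have "?Y = {y}" by blast
  then have "x \<odot>\<^bsub>transport_embed (n - 1) n (tableau_module \<beta> [])\<^esub> v = y"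
    unfolding transport_embed_def by simp
  with rep_Y[OF y]
  show "Poly_Mapping.keys (x \<odot>\<^bsub>transport_embed (n - 1) n (tableau_module \<beta> [])\<^esub> v) \<subseteq> SIT \<beta> []"
    and "?\<rho> (x \<odot>\<^bsub>transport_embed (n - 1) n (tableau_module \<beta> [])\<^esub> v) =
      x \<odot>\<^bsub>tableau_module \<alpha> []\<^esub> ?\<rho> v"
    by simp_all
qed

lemma restrict_one_less:
  assumes \<alpha>: "is_composition \<alpha> n" and n: "1 \<le> n"
  shows "module_isomorphic (hecke_subalgebra n {1..<n - 1}) (tableau_module \<alpha> [])
    (direct_sum {\<beta>. is_composition \<beta> (n - 1) \<and> comp_contained \<beta> \<alpha>}
      (\<lambda>\<beta>. transport_embed (n - 1) n (tableau_module \<beta> [])))"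
proof -
  let ?I = "{\<beta>. is_composition \<beta> (n - 1) \<and> comp_contained \<beta> \<alpha>}"
  define U :: "nat list \<Rightarrow> tableau" where "U \<beta> = (\<lambda>c\<in>skew_diagram \<alpha> \<beta>. 1)" for \<beta>
  have SIT: "SIT \<alpha> \<beta> = {U \<beta>}" if "\<beta> \<in> ?I" for \<beta>
  proof -
    have one: "sum_list \<alpha> - sum_list \<beta> = 1" using that \<alpha> n by (auto simp: is_composition_def)
    then have "card (skew_diagram \<alpha> \<beta>) = 1"
      using that by (simp add: card_skew_diagram)
    then obtain c where "skew_diagram \<alpha> \<beta> = {c}" by (rule card_1_singletonE)
    then show ?thesis unfolding U_def using one by (rule SIT_single_cell)
  qed
  \<comment> \<open>The skew tableau is determined by \<beta>, so it can be added as a third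
    component and \<open>bij_betw_glue\<close> composed with the result.\<close>
  have "bij_betw (\<lambda>(\<beta>, T). (\<beta>, T, U \<beta>)) (SIGMA \<beta>:?I. SIT \<beta> []) (SIGMA \<beta>:?I. SIT \<beta> [] \<times> {U \<beta>})"
    by (intro bij_betw_byWitness[where f' = "\<lambda>(\<beta>, T, U). (\<beta>, T)"]) auto
  also have "(SIGMA \<beta>:?I. SIT \<beta> [] \<times> {U \<beta>}) = (SIGMA \<beta>:?I. SIT \<beta> [] \<times> SIT \<alpha> \<beta>)"
    by (intro Sigma_cong refl) (simp only: SIT)
  finally have "bij_betw (\<lambda>(\<beta>, T). (\<beta>, T, U \<beta>)) (SIGMA \<beta>:?I. SIT \<beta> []) (SIGMA \<beta>:?I. SIT \<beta> [] \<times> SIT \<alpha> \<beta>)" .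
  from bij_betw_trans[OF this bij_betw_glue[OF \<alpha> diff_le_self]]
  have bij: "bij_betw (\<lambda>(\<beta>, T). glue \<alpha> \<beta> (n - 1) T (U \<beta>)) (SIGMA \<beta>:?I. SIT \<beta> []) (SIT \<alpha> [])"
    by (simp add: o_def case_prod_unfold)
  show ?thesis
  proof (rule module_isomorphic_direct_sum[OF _ _ _ _ _ _ _ _ bij])
    show "left_module (hecke_subalgebra n {1..<n - 1}) (tableau_module \<alpha> [])"
      by (rule left_module_restrict[OF \<alpha>]) auto
    show "finite ?I" by (rule finite_contained_compositions)
  next
    fix \<beta> x v assume \<beta>: "\<beta> \<in> ?I" and x: "x \<in> carrier (hecke_subalgebra n {1..<n - 1})"
      and v: "v \<in> carrier (transport_embed (n - 1) n (tableau_module \<beta> []))"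
    show "x \<odot>\<^bsub>transport_embed (n - 1) n (tableau_module \<beta> [])\<^esub> v
          \<in> carrier (transport_embed (n - 1) n (tableau_module \<beta> [])) \<and>
        relabel (\<lambda>T. glue \<alpha> \<beta> (n - 1) T (U \<beta>)) (x \<odot>\<^bsub>transport_embed (n - 1) n (tableau_module \<beta> [])\<^esub> v) =
          x \<odot>\<^bsub>tableau_module \<alpha> []\<^esub> relabel (\<lambda>T. glue \<alpha> \<beta> (n - 1) T (U \<beta>)) v"
      using transport_embed_smult[OF \<alpha> n _ _ _ x, of \<beta> "U \<beta>" v] \<beta> v SIT[OF \<beta>]
      by (simp add: transport_embed_def)
  qed (simp_all add: transport_embed_def)
qed

theorem theorem5p1:
  fixes \<alpha> :: "nat list" and n m :: nat
  assumes "is_composition \<alpha> n" and "m \<le> n"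
  shows
    "module_isomorphic (hecke_tensor m n)
       (tableau_module \<alpha> [])
       (direct_sum {\<beta>. is_composition \<beta> m \<and> comp_contained \<beta> \<alpha>}
          (\<lambda>\<beta>. tensor_module m n (tableau_module \<beta> []) (tableau_module \<alpha> \<beta>)))
     \<and>
     (1 \<le> n \<longrightarrow>
       module_isomorphic (hecke_subalgebra n {1..<n - 1})
         (tableau_module \<alpha> [])
         (direct_sum {\<beta>. is_composition \<beta> (n - 1) \<and> comp_contained \<beta> \<alpha> \<and> \<beta> \<noteq> \<alpha>}
            (\<lambda>\<beta>. transport_embed (n - 1) n (tableau_module \<beta> [])))
       \<and>
       {\<beta>. is_composition \<beta> (n - 1) \<and> comp_contained \<beta> \<alpha> \<and> \<beta> \<noteq> \<alpha>} =
         {\<beta>. is_composition \<beta> (sum_list \<beta>) \<and> comp_contained \<beta> \<alpha> \<and> card (skew_diagram \<alpha> \<beta>) = 1})"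
  using restrict_tensor[OF assms] restrict_one_less[OF assms(1)]
    contained_compositions_one_less[OF assms(1)] by simp

end
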